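(* Let $\varphi : R \to S$ be a homomorphism of commutative rings, let $L$ be an $R$-module, and let $M$ be an $S$-module that is flat as an $R$-module (via $\varphi$). Then \[ \mathrm{sK}_S(L \otimes_R M) \supseteq \bigcup_{\mathfrak{p} \in \mathrm{sK}_R(L)} \mathrm{sK}_S(M/\mathfrak{p} M). \]
   Context: All rings are commutative with unity and not necessarily Noetherian. For a ring $A$ and an $A$-module $N$, the set $\mathrm{sK}_A(N)$ of strong Krull primes of $N$ is the set of all $\mathfrak{p} \in \mathrm{Spec}\, A$ such that for every finitely generated ideal $I$ of $A$ with $I \subseteq \mathfrak{p}$ there is an element $z \in N$ with $I \subseteq \mathrm{ann}_A(z) \subseteq \mathfrak{p}$. The $S$-module structure on $L \otimes_R M$ is via the factor $M$. *)

theory Defs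
  imports "HOL-Algebra.Module" "HOL-Algebra.Ideal" "HOL-Algebra.Free_Abelian_Groups"
begin

text \<open>
  Modules are those of the locale \<^locale>\<open>module\<close>. Its underlying record extends the ring
  record, but the locale never looks at the fields \<open>mult\<close> and \<open>one\<close>, so the constructions below
  leave them unspecified.
\<close>

definition mod_hom ::
  "('a, 'x) ring_scheme \<Rightarrow> ('a, 'b, 'y) module_scheme \<Rightarrow> ('a, 'c, 'z) module_scheme \<Rightarrow> ('b \<Rightarrow> 'c) set"
  where "mod_hom R M N =
    {f \<in> carrier M \<rightarrow> carrier N.
       (\<forall>x\<in>carrier M. \<forall>y\<in>carrier M. f (x \<oplus>\<^bsub>M\<^esub> y) = f x \<oplus>\<^bsub>N\<^esub> f y) \<and>
       (\<forall>r\<in>carrier R. \<forall>x\<in>carrier M. f (r \<odot>\<^bsub>M\<^esub> x) = r \<odot>\<^bsub>N\<^esub> f x)}"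

definition restrict_scalars :: "('r \<Rightarrow> 's) \<Rightarrow> ('s, 'm, 'x) module_scheme \<Rightarrow> ('r, 'm) module"
  where "restrict_scalars \<phi> M =
    \<lparr>carrier = carrier M, mult = undefined, one = undefined,
     ring.zero = \<zero>\<^bsub>M\<^esub>, add = (\<oplus>\<^bsub>M\<^esub>), smult = (\<lambda>r x. \<phi> r \<odot>\<^bsub>M\<^esub> x)\<rparr>"

definition ideal_smult :: "'r set \<Rightarrow> ('r, 'm, 'x) module_scheme \<Rightarrow> 'm set"
  where "ideal_smult I M = generate (add_monoid M) {a \<odot>\<^bsub>M\<^esub> x | a x. a \<in> I \<and> x \<in> carrier M}"

text \<open>
  For a submodule \<open>N\<close>, all cosets in the union defining the scalar action coincide; the union
  only avoids choosing a representative. The same device is used in \<open>tensor_map\<close> below.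
\<close>

definition quotient_module :: "('s, 'm, 'x) module_scheme \<Rightarrow> 'm set \<Rightarrow> ('s, 'm set) module"
  where "quotient_module M N =
    \<lparr>carrier = a_rcosets\<^bsub>M\<^esub> N, mult = undefined, one = undefined,
     ring.zero = N, add = set_add M, smult = (\<lambda>s X. \<Union>x\<in>X. N +>\<^bsub>M\<^esub> (s \<odot>\<^bsub>M\<^esub> x))\<rparr>"

definition annihilator :: "('a, 'x) ring_scheme \<Rightarrow> ('a, 'n, 'y) module_scheme \<Rightarrow> 'n \<Rightarrow> 'a set"
  where "annihilator A N z = {a \<in> carrier A. a \<odot>\<^bsub>N\<^esub> z = \<zero>\<^bsub>N\<^esub>}"

definition fin_gen_ideal :: "'a set \<Rightarrow> ('a, 'x) ring_scheme \<Rightarrow> bool"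
  where "fin_gen_ideal I A \<longleftrightarrow> (\<exists>F. finite F \<and> F \<subseteq> carrier A \<and> I = genideal A F)"

definition strong_Krull :: "('a, 'x) ring_scheme \<Rightarrow> ('a, 'n, 'y) module_scheme \<Rightarrow> 'a set set"
  where "strong_Krull A N =
    {p. primeideal p A \<and>
        (\<forall>I. fin_gen_ideal I A \<and> I \<subseteq> p \<longrightarrow>
          (\<exists>z\<in>carrier N. I \<subseteq> annihilator A N z \<and> annihilator A N z \<subseteq> p))}"

text \<open>
  The tensor product is the free abelian group on pairs modulo the subgroup generated by the
  bilinearity and balancing relators. (\<^const>\<open>free_Abelian_group\<close> is written multiplicatively,
  its elements are finitely supported integer-valued functions.)
\<close>

definition tensor_relators ::
  "('r, 'x) ring_scheme \<Rightarrow> ('r, 'l, 'y) module_scheme \<Rightarrow> ('r, 'm, 'z) module_scheme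
    \<Rightarrow> ('l \<times> 'm \<Rightarrow>\<^sub>0 int) set"
  where "tensor_relators R L M =
    {frag_of (x \<oplus>\<^bsub>L\<^esub> x', y) - (frag_of (x, y) + frag_of (x', y)) | x x' y.
       x \<in> carrier L \<and> x' \<in> carrier L \<and> y \<in> carrier M} \<union>
    {frag_of (x, y \<oplus>\<^bsub>M\<^esub> y') - (frag_of (x, y) + frag_of (x, y')) | x y y'.
       x \<in> carrier L \<and> y \<in> carrier M \<and> y' \<in> carrier M} \<union>
    {frag_of (r \<odot>\<^bsub>L\<^esub> x, y) - frag_of (x, r \<odot>\<^bsub>M\<^esub> y) | r x y.
       r \<in> carrier R \<and> x \<in> carrier L \<and> y \<in> carrier M}"

definition tensor_null ::
  "('r, 'x) ring_scheme \<Rightarrow> ('r, 'l, 'y) module_scheme \<Rightarrow> ('r, 'm, 'z) module_scheme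
    \<Rightarrow> ('l \<times> 'm \<Rightarrow>\<^sub>0 int) set"
  where "tensor_null R L M =
    generate (free_Abelian_group (carrier L \<times> carrier M)) (tensor_relators R L M)"

definition tensor_group ::
  "('r, 'x) ring_scheme \<Rightarrow> ('r, 'l, 'y) module_scheme \<Rightarrow> ('r, 'm, 'z) module_scheme
    \<Rightarrow> ('l \<times> 'm \<Rightarrow>\<^sub>0 int) set monoid"
  where "tensor_group R L M =
    free_Abelian_group (carrier L \<times> carrier M) Mod tensor_null R L M"

text \<open>
  The map \<open>f \<otimes> g\<close> into \<open>L' \<otimes>\<^sub>R M'\<close> induced by \<open>f : L \<rightarrow> L'\<close> and \<open>g : M \<rightarrow> M'\<close>;
  \<open>L\<close> and \<open>M\<close> are not needed as arguments.
\<close>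

definition tensor_map ::
  "('r, 'x) ring_scheme \<Rightarrow> ('r, 'l2, 'y) module_scheme \<Rightarrow> ('r, 'm2, 'z) module_scheme
    \<Rightarrow> ('l1 \<Rightarrow> 'l2) \<Rightarrow> ('m1 \<Rightarrow> 'm2) \<Rightarrow> ('l1 \<times> 'm1 \<Rightarrow>\<^sub>0 int) set \<Rightarrow> ('l2 \<times> 'm2 \<Rightarrow>\<^sub>0 int) set"
  where "tensor_map R L' M' f g X =
    (\<Union>z\<in>X. tensor_null R L' M' #>\<^bsub>free_Abelian_group (carrier L' \<times> carrier M')\<^esub>
             frag_extend (\<lambda>(x, y). frag_of (f x, g y)) z)"

text \<open>
  For an \<open>R\<close>-module \<open>L\<close> and an \<open>S\<close>-module \<open>M\<close>: the \<open>S\<close>-module \<open>L \<otimes>\<^sub>R M\<close>, where \<open>s\<close> acts as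
  \<open>id \<otimes> s\<close>.
\<close>

definition tensor_module ::
  "('r, 'x) ring_scheme \<Rightarrow> ('r \<Rightarrow> 's) \<Rightarrow> ('r, 'l, 'y) module_scheme \<Rightarrow> ('s, 'm, 'z) module_scheme
    \<Rightarrow> ('s, ('l \<times> 'm \<Rightarrow>\<^sub>0 int) set) module"
  where "tensor_module R \<phi> L M =
    (let M\<^sub>R = restrict_scalars \<phi> M; T = tensor_group R L M\<^sub>R in
      \<lparr>carrier = carrier T, mult = undefined, one = undefined,
       ring.zero = \<one>\<^bsub>T\<^esub>, add = mult T,
       smult = (\<lambda>s. tensor_map R L M\<^sub>R (\<lambda>x. x) (\<lambda>y. s \<odot>\<^bsub>M\<^esub> y))\<rparr>)"

text \<open>
  Flatness: tensoring with \<open>M\<close> preserves injectivity of \<open>R\<close>-linear maps. A definition in HOL cannot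
  quantify over all types, so the test modules have their carriers in the type underlying \<open>R\<close>.
  This is no loss: it includes all inclusions of ideals into \<open>R\<close>, and if tensoring with \<open>M\<close> keeps
  those injective then it keeps every injective linear map injective.
\<close>

definition flat_module :: "('r, 'x) ring_scheme \<Rightarrow> ('r, 'm, 'y) module_scheme \<Rightarrow> bool"
  where "flat_module R M \<longleftrightarrow>
    module R M \<and>
    (\<forall>(N :: ('r, 'r) module) (N' :: ('r, 'r) module). \<forall>f\<in>mod_hom R N N'.
       module R N \<and> module R N' \<and> inj_on f (carrier N) \<longrightarrow>
       inj_on (tensor_map R N' M f (\<lambda>y. y)) (carrier (tensor_group R N M)))"

end

theory Submission
  imports Defs
begin

text \<open>
  If \<open>l \<in> L\<close> and \<open>M\<close> is flat over \<open>R\<close>, then \<open>l \<otimes> x = 0\<close> only for \<open>x \<in> ann(l) M\<close>, so the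
  annihilator of \<open>l \<otimes> x\<close> in \<open>S\<close> is the colon ideal \<open>(ann(l) M : x)\<close>. Let \<open>J \<subseteq> \<qq>\<close> be finitely
  generated and \<open>x + \<pp>M\<close> an element with \<open>J \<subseteq> ann(x + \<pp>M) \<subseteq> \<qq>\<close>. Since \<open>J\<close> is finitely generated,
  \<open>J x \<subseteq> I M\<close> for a finitely generated \<open>I \<subseteq> \<pp>\<close>; choosing \<open>l\<close> with \<open>I \<subseteq> ann(l) \<subseteq> \<pp>\<close> gives
  \<open>J \<subseteq> ann(l \<otimes> x) \<subseteq> ann(x + \<pp>M) \<subseteq> \<qq>\<close>.

  Flatness is only given for modules carried by the type of \<open>R\<close>, whereas \<open>L\<close> is arbitrary, so the
  injectivity of \<open>R l \<otimes> M \<rightarrow> L \<otimes> M\<close> is derived from ideals alone. Sending \<open>y \<otimes> m\<close> to the function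
  \<open>\<delta>\<^sub>y m : L \<rightarrow> M\<close> shows that if \<open>l \<otimes> x = 0\<close> then \<open>\<delta>\<^sub>l x\<close> is a sum of terms \<open>k m\<close>, where the
  \<open>k : L \<rightarrow> R\<close> are syzygies with support in a common finite set. The flatness of \<open>M\<close> for the ideal
  of values \<open>k(z)\<close> allows one to take all \<open>k\<close> zero at \<open>z\<close>, for one point \<open>z \<noteq> l\<close> after the other;
  what remains are syzygies supported at \<open>l\<close>, that is, elements of \<open>ann(l)\<close>.
\<close>

section \<open>Relations in the tensor product\<close>

lemma keys_diff_subset:
  "Poly_Mapping.keys a \<subseteq> S \<Longrightarrow> Poly_Mapping.keys b \<subseteq> S \<Longrightarrow> Poly_Mapping.keys (a - b) \<subseteq> S"
  using keys_diff[of a b] by blast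

lemma keys_add_subset:
  "Poly_Mapping.keys a \<subseteq> S \<Longrightarrow> Poly_Mapping.keys b \<subseteq> S \<Longrightarrow> Poly_Mapping.keys (a + b) \<subseteq> S"
  using keys_add[of a b] by blast

text \<open>Stands in for an induction over generated elements, for the relators of the tensor
  product, for pointwise spans and for \<open>ideal_smult\<close> alike.\<close>

lemma generate_hom_subset:
  assumes "group G" "group G'" "h \<in> hom G G'" "subgroup H G'" "A \<subseteq> carrier G" "\<And>a. a \<in> A \<Longrightarrow> h a \<in> H"
    and "g \<in> generate G A"
  shows "h g \<in> H"
proof -
  interpret h: group_hom G G' h
    using assms(1-3) by (simp add: group_hom_def group_hom_axioms_def)
  have "generate G' (h ` A) \<subseteq> H"
    using h.H.generate_subgroup_incl[OF _ assms(4)] assms(6) by blast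
  then show ?thesis
    using h.generate_img[OF assms(5)] assms(7) by blast
qed

lemma tensor_relators_carrier:
  assumes "module R L" "module R M"
  shows "tensor_relators R L M \<subseteq> carrier (free_Abelian_group (carrier L \<times> carrier M))"
proof -
  interpret L: module R L by fact
  interpret M: module R M by fact
  show ?thesis
    unfolding tensor_relators_def
    by (intro Un_least; clarify; unfold carrier_free_Abelian_group_iff;
        intro keys_diff_subset keys_add_subset; simp)
qed

lemma tensor_null_subgroup:
  assumes "module R L" "module R M"
  shows "subgroup (tensor_null R L M) (free_Abelian_group (carrier L \<times> carrier M))"
  unfolding tensor_null_def
  by (rule group.generate_is_subgroup[OF group_free_Abelian_group tensor_relators_carrier[OF assms]])

lemma tensor_null_closed:
  assumes "module R L" "module R M"
  shows "0 \<in> tensor_null R L M"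
    and "a \<in> tensor_null R L M \<Longrightarrow> b \<in> tensor_null R L M \<Longrightarrow> a + b \<in> tensor_null R L M"
    and "a \<in> tensor_null R L M \<Longrightarrow> - a \<in> tensor_null R L M"
    and "a \<in> tensor_null R L M \<Longrightarrow> b \<in> tensor_null R L M \<Longrightarrow> a - b \<in> tensor_null R L M"
    and "a \<in> tensor_null R L M \<Longrightarrow> Poly_Mapping.keys a \<subseteq> carrier L \<times> carrier M"
proof -
  interpret N: subgroup "tensor_null R L M" "free_Abelian_group (carrier L \<times> carrier M)"
    by (rule tensor_null_subgroup[OF assms])
  show "0 \<in> tensor_null R L M" using N.one_closed by simp
  show add: "a \<in> tensor_null R L M \<Longrightarrow> b \<in> tensor_null R L M \<Longrightarrow> a + b \<in> tensor_null R L M" for a b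
    using N.m_closed by simp
  show k: "a \<in> tensor_null R L M \<Longrightarrow> Poly_Mapping.keys a \<subseteq> carrier L \<times> carrier M" for a
    using subsetD[OF N.subset] by (simp only: carrier_free_Abelian_group_iff)
  show minus: "a \<in> tensor_null R L M \<Longrightarrow> - a \<in> tensor_null R L M" for a
    using N.m_inv_closed k by fastforce
  show "a \<in> tensor_null R L M \<Longrightarrow> b \<in> tensor_null R L M \<Longrightarrow> a - b \<in> tensor_null R L M"
    using add[of a "- b"] minus[of b] by simp
qed

lemma tensor_null_relators:
  assumes "x \<in> carrier L" "x' \<in> carrier L" "y \<in> carrier M" "y' \<in> carrier M" "r \<in> carrier R"
  shows "frag_of (x \<oplus>\<^bsub>L\<^esub> x', y) - (frag_of (x, y) + frag_of (x', y)) \<in> tensor_null R L M"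
    and "frag_of (x, y \<oplus>\<^bsub>M\<^esub> y') - (frag_of (x, y) + frag_of (x, y')) \<in> tensor_null R L M"
    and "frag_of (r \<odot>\<^bsub>L\<^esub> x, y) - frag_of (x, r \<odot>\<^bsub>M\<^esub> y) \<in> tensor_null R L M"
  unfolding tensor_null_def
  by (rule generate.incl; unfold tensor_relators_def; use assms in blast)+

lemma tensor_null_hom:
  assumes "module R L" "module R M" "group G" "h \<in> hom (free_Abelian_group (carrier L \<times> carrier M)) G"
    and "subgroup H G" "\<And>a. a \<in> tensor_relators R L M \<Longrightarrow> h a \<in> H" "a \<in> tensor_null R L M"
  shows "h a \<in> H"
  using generate_hom_subset[OF group_free_Abelian_group assms(3,4,5) tensor_relators_carrier[OF assms(1,2)] assms(6)]
    assms(7) unfolding tensor_null_def by blast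

text \<open>Additivity applied to \<open>0 + 0 = 0\<close> gives a relator that collapses to the
  negative of the pair.\<close>

lemma tensor_null_zero:
  assumes "module R L" "module R M" "x \<in> carrier L" "y \<in> carrier M"
  shows "frag_of (x, \<zero>\<^bsub>M\<^esub>) \<in> tensor_null R L M"
    and "frag_of (\<zero>\<^bsub>L\<^esub>, y) \<in> tensor_null R L M"
proof -
  interpret L: module R L by fact
  interpret M: module R M by fact
  have "- (frag_of (x, \<zero>\<^bsub>M\<^esub>) - (frag_of (x, \<zero>\<^bsub>M\<^esub>) + frag_of (x, \<zero>\<^bsub>M\<^esub>))) \<in> tensor_null R L M"
    using tensor_null_relators(2)[of x L x "\<zero>\<^bsub>M\<^esub>" M "\<zero>\<^bsub>M\<^esub>" "\<zero>\<^bsub>R\<^esub>" R] assms(3)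
    by (intro tensor_null_closed(3)[OF assms(1,2)]) auto
  then show "frag_of (x, \<zero>\<^bsub>M\<^esub>) \<in> tensor_null R L M" by simp
  have "- (frag_of (\<zero>\<^bsub>L\<^esub>, y) - (frag_of (\<zero>\<^bsub>L\<^esub>, y) + frag_of (\<zero>\<^bsub>L\<^esub>, y))) \<in> tensor_null R L M"
    using tensor_null_relators(1)[of "\<zero>\<^bsub>L\<^esub>" L "\<zero>\<^bsub>L\<^esub>" y M y "\<zero>\<^bsub>R\<^esub>" R] assms(4)
    by (intro tensor_null_closed(3)[OF assms(1,2)]) auto
  then show "frag_of (\<zero>\<^bsub>L\<^esub>, y) \<in> tensor_null R L M" by simp
qed

text \<open>Linearity of \<open>f\<close> and \<open>g\<close> carries each relator to a relator of
  the same kind; hence \<open>f \<otimes> g\<close> does not depend on representatives.\<close>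

lemma tensor_null_frag_extend:
  assumes "module R L" "module R M" "module R L'" "module R M'" "f \<in> mod_hom R L L'" "g \<in> mod_hom R M M'"
    and "a \<in> tensor_null R L M"
  shows "frag_extend (\<lambda>(x, y). frag_of (f x, g y)) a \<in> tensor_null R L' M'"
proof (rule tensor_null_hom[OF assms(1,2) _ _ tensor_null_subgroup[OF assms(3,4)] _ assms(7)])
  have fg: "f \<in> carrier L \<rightarrow> carrier L'" "g \<in> carrier M \<rightarrow> carrier M'"
    using assms(5,6) by (auto simp: mod_hom_def)
  show "group (free_Abelian_group (carrier L' \<times> carrier M'))" by simp
  show "frag_extend (\<lambda>(x, y). frag_of (f x, g y))
    \<in> hom (free_Abelian_group (carrier L \<times> carrier M)) (free_Abelian_group (carrier L' \<times> carrier M'))"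
  proof (rule homI)
    fix x assume "x \<in> carrier (free_Abelian_group (carrier L \<times> carrier M))"
    then show "frag_extend (\<lambda>(x, y). frag_of (f x, g y)) x \<in> carrier (free_Abelian_group (carrier L' \<times> carrier M'))"
      using fg by (fastforce dest!: subsetD[OF keys_frag_extend])
  qed (simp add: frag_extend_add)
  fix a assume "a \<in> tensor_relators R L M"
  then have "frag_extend (\<lambda>(x, y). frag_of (f x, g y)) a \<in> tensor_relators R L' M'"
    unfolding tensor_relators_def Un_iff mem_Collect_eq
  proof (elim disjE exE conjE, goal_cases)
    case (1 x x' y)
    then have "frag_extend (\<lambda>(x, y). frag_of (f x, g y)) a =
      frag_of (f x \<oplus>\<^bsub>L'\<^esub> f x', g y) - (frag_of (f x, g y) + frag_of (f x', g y))"
      using assms(5) by (simp add: frag_extend_diff frag_extend_add mod_hom_def)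
    with 1 fg show ?case by blast
  next
    case (2 x y y')
    then have "frag_extend (\<lambda>(x, y). frag_of (f x, g y)) a =
      frag_of (f x, g y \<oplus>\<^bsub>M'\<^esub> g y') - (frag_of (f x, g y) + frag_of (f x, g y'))"
      using assms(6) by (simp add: frag_extend_diff frag_extend_add mod_hom_def)
    with 2 fg show ?case by blast
  next
    case (3 r x y)
    then have "frag_extend (\<lambda>(x, y). frag_of (f x, g y)) a =
      frag_of (r \<odot>\<^bsub>L'\<^esub> f x, g y) - frag_of (f x, r \<odot>\<^bsub>M'\<^esub> g y)"
      using assms(5,6) by (simp add: frag_extend_diff frag_extend_add mod_hom_def)
    with 3 fg show ?case by blast
  qed
  then show "frag_extend (\<lambda>(x, y). frag_of (f x, g y)) a \<in> tensor_null R L' M'"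
    unfolding tensor_null_def by (rule generate.incl)
qed

lemma tensor_null_coset_eq:
  assumes "module R L" "module R M" "Poly_Mapping.keys a \<subseteq> carrier L \<times> carrier M"
  shows "tensor_null R L M #>\<^bsub>free_Abelian_group (carrier L \<times> carrier M)\<^esub> a = tensor_null R L M
    \<longleftrightarrow> a \<in> tensor_null R L M"
  using group.coset_join1[OF group_free_Abelian_group _ _ tensor_null_subgroup[OF assms(1,2)], of a]
    group.coset_join2[OF group_free_Abelian_group _ tensor_null_subgroup[OF assms(1,2)], of a] assms(3)
  by auto

text \<open>The union in \<open>tensor_map\<close> runs over the representatives
  \<open>n + a\<close> with \<open>n\<close> null, and all of them give the same coset because the
  image of \<open>n\<close> is null.\<close>

lemma tensor_map_coset:
  assumes "module R L" "module R M" "module R L'" "module R M'" "f \<in> mod_hom R L L'" "g \<in> mod_hom R M M'"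
    and "Poly_Mapping.keys a \<subseteq> carrier L \<times> carrier M"
  shows "tensor_map R L' M' f g (tensor_null R L M #>\<^bsub>free_Abelian_group (carrier L \<times> carrier M)\<^esub> a) =
    tensor_null R L' M' #>\<^bsub>free_Abelian_group (carrier L' \<times> carrier M')\<^esub> frag_extend (\<lambda>(x, y). frag_of (f x, g y)) a"
    (is "_ = ?N' #>\<^bsub>?F\<^esub> ?h a")
proof -
  have "?N' #>\<^bsub>?F\<^esub> ?h (n + a) = ?N' #>\<^bsub>?F\<^esub> ?h a" if n: "n \<in> tensor_null R L M" for n
  proof -
    have hn: "?h n \<in> ?N'" by (rule tensor_null_frag_extend[OF assms(1-6) n])
    have "(\<lambda>z. z + (?h n + ?h a)) ` ?N' = (\<lambda>z. z + ?h a) ` ?N'"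
    proof (intro equalityI subsetI; elim imageE)
      fix x z assume z: "x = z + (?h n + ?h a)" "z \<in> ?N'"
      then have "x = (z + ?h n) + ?h a" by (simp add: add.assoc)
      then show "x \<in> (\<lambda>z. z + ?h a) ` ?N'"
        using tensor_null_closed(2)[OF assms(3,4) z(2) hn] by blast
    next
      fix x z assume z: "x = z + ?h a" "z \<in> ?N'"
      then have "x = (z - ?h n) + (?h n + ?h a)" by simp
      then show "x \<in> (\<lambda>z. z + (?h n + ?h a)) ` ?N'"
        using tensor_null_closed(4)[OF assms(3,4) z(2) hn] by blast
    qed
    then show ?thesis by (auto simp: r_coset_def frag_extend_add)
  qed
  \<comment> \<open>A union over no representatives would be empty instead of a coset.\<close>
  moreover have "tensor_null R L M \<noteq> {}" using tensor_null_closed(1)[OF assms(1,2)] by blast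
  ultimately show ?thesis
    unfolding tensor_map_def by (auto simp: r_coset_def)
qed

text \<open>A lifted universal property: \<open>f\<close> represents a balanced map into
  \<open>G\<close> modulo \<open>H\<close>, so it may miss additivity in the first argument and
  balancing by an error in \<open>H\<close>. This suits maps such as a nonlinear section or
  \<open>y \<mapsto> \<delta>\<^sub>y\<close>.\<close>

lemma tensor_null_bilinear:
  assumes "module R L" "module R M" "comm_group G" "subgroup H G"
    and f: "\<And>x y. x \<in> carrier L \<Longrightarrow> y \<in> carrier M \<Longrightarrow> f x y \<in> carrier G"
    and add1: "\<And>x x' y. x \<in> carrier L \<Longrightarrow> x' \<in> carrier L \<Longrightarrow> y \<in> carrier M \<Longrightarrow>
      \<exists>d\<in>H. f (x \<oplus>\<^bsub>L\<^esub> x') y = d \<otimes>\<^bsub>G\<^esub> (f x y \<otimes>\<^bsub>G\<^esub> f x' y)"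
    and add2: "\<And>x y y'. x \<in> carrier L \<Longrightarrow> y \<in> carrier M \<Longrightarrow> y' \<in> carrier M \<Longrightarrow>
      f x (y \<oplus>\<^bsub>M\<^esub> y') = f x y \<otimes>\<^bsub>G\<^esub> f x y'"
    and bal: "\<And>r x y. r \<in> carrier R \<Longrightarrow> x \<in> carrier L \<Longrightarrow> y \<in> carrier M \<Longrightarrow>
      \<exists>d\<in>H. f (r \<odot>\<^bsub>L\<^esub> x) y = d \<otimes>\<^bsub>G\<^esub> f x (r \<odot>\<^bsub>M\<^esub> y)"
  shows "\<exists>h \<in> hom (free_Abelian_group (carrier L \<times> carrier M)) G.
    (\<forall>x\<in>carrier L. \<forall>y\<in>carrier M. h (frag_of (x, y)) = f x y) \<and> h ` tensor_null R L M \<subseteq> H"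
proof -
  interpret L: module R L by fact
  interpret M: module R M by fact
  interpret G: comm_group G by fact
  interpret H: subgroup H G by fact
  let ?F = "free_Abelian_group (carrier L \<times> carrier M)"
  have "case_prod f ` (carrier L \<times> carrier M) \<subseteq> carrier G"
    using f by auto
  then obtain h where h: "h \<in> hom ?F G" and "\<And>z. z \<in> carrier L \<times> carrier M \<Longrightarrow> h (frag_of z) = case_prod f z"
    by (rule G.free_Abelian_group_universal) blast
  then have hf: "h (frag_of (x, y)) = f x y" if "x \<in> carrier L" "y \<in> carrier M" for x y
    using that by fastforce
  interpret h: group_hom ?F G h
    using h by (simp add: group_hom_def group_hom_axioms_def)
  \<comment> \<open>Each relator is a difference \<open>a - b\<close>, so cancelling
    \<open>h b\<close> identifies its image with the error \<open>d\<close>.\<close>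
  have diff: "h (a - b) \<in> H"
    if "Poly_Mapping.keys a \<subseteq> carrier L \<times> carrier M" "Poly_Mapping.keys b \<subseteq> carrier L \<times> carrier M"
      "d \<in> H" "h a = d \<otimes>\<^bsub>G\<^esub> h b" for a b d
  proof -
    have "h a = h (a - b) \<otimes>\<^bsub>G\<^esub> h b"
      using h.hom_mult[of "a - b" b] that(1,2) keys_diff_subset[OF that(1,2)] by simp
    moreover have "h (a - b) \<in> carrier G" "h b \<in> carrier G"
      using h.hom_closed that(1,2) keys_diff_subset[OF that(1,2)] by simp_all
    ultimately have "h (a - b) = d"
      using that(3,4) G.right_cancel[of "h b" "h (a - b)" d] H.mem_carrier[of d] by simp
    with that(3) show ?thesis by simp
  qed
  have sum: "h (frag_of u + frag_of v) = h (frag_of u) \<otimes>\<^bsub>G\<^esub> h (frag_of v)"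
    if "u \<in> carrier L \<times> carrier M" "v \<in> carrier L \<times> carrier M" for u v
    using h.hom_mult[of "frag_of u" "frag_of v"] that by simp
  have "h a \<in> H" if "a \<in> tensor_relators R L M" for a
    using that unfolding tensor_relators_def Un_iff mem_Collect_eq
  proof (elim disjE exE conjE, goal_cases)
    case (1 x x' y)
    then obtain d where "d \<in> H" "f (x \<oplus>\<^bsub>L\<^esub> x') y = d \<otimes>\<^bsub>G\<^esub> (f x y \<otimes>\<^bsub>G\<^esub> f x' y)"
      using add1 by blast
    then show ?case unfolding 1(1)
      by (intro diff[of _ _ d] keys_add_subset) (use 1 in \<open>simp_all add: sum hf\<close>)
  next
    case (2 x y y')
    then have "f x (y \<oplus>\<^bsub>M\<^esub> y') = \<one>\<^bsub>G\<^esub> \<otimes>\<^bsub>G\<^esub> (f x y \<otimes>\<^bsub>G\<^esub> f x y')"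
      using add2 f by simp
    then show ?case unfolding 2(1)
      by (intro diff[of _ _ "\<one>\<^bsub>G\<^esub>"] keys_add_subset) (use 2 in \<open>simp_all add: sum hf\<close>)
  next
    case (3 r x y)
    then obtain d where "d \<in> H" "f (r \<odot>\<^bsub>L\<^esub> x) y = d \<otimes>\<^bsub>G\<^esub> f x (r \<odot>\<^bsub>M\<^esub> y)"
      using bal by blast
    then show ?case unfolding 3(1)
      by (intro diff[of _ _ d]) (use 3 in \<open>simp_all add: hf\<close>)
  qed
  then have "h a \<in> H" if "a \<in> tensor_null R L M" for a
    using tensor_null_hom[OF assms(1,2) G.is_group h assms(4) _ that] by blast
  with h hf show ?thesis by blast
qed

section \<open>Spans of function modules\<close>

text \<open>A direct power of \<open>M\<close>, with no condition on supports, written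
  multiplicatively because \<open>generate\<close> and \<open>hom\<close> expect a monoid.\<close>

definition pointwise_group :: "('r, 'm, 'x) module_scheme \<Rightarrow> ('i \<Rightarrow> 'm) monoid"
  where "pointwise_group M = \<lparr>carrier = UNIV \<rightarrow> carrier M,
    mult = (\<lambda>v w i. v i \<oplus>\<^bsub>M\<^esub> w i), one = (\<lambda>_. \<zero>\<^bsub>M\<^esub>)\<rparr>"

text \<open>For a submodule \<open>K\<close> of functions this is the image of
  \<open>K \<otimes> M\<close> in the power of \<open>M\<close>, under
  \<open>k \<otimes> m \<mapsto> (i \<mapsto> k i m)\<close>.\<close>

definition pointwise_span :: "('i \<Rightarrow> 'r) set \<Rightarrow> ('r, 'm, 'x) module_scheme \<Rightarrow> ('i \<Rightarrow> 'm) set"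
  where "pointwise_span K M =
    generate (pointwise_group M) {\<lambda>i. k i \<odot>\<^bsub>M\<^esub> m | k m. k \<in> K \<and> m \<in> carrier M}"

text \<open>A submodule of a power of \<open>R\<close>; negatives come from scaling by
  \<open>-1\<close>.\<close>

definition fun_submodule :: "('r, 'x) ring_scheme \<Rightarrow> ('i \<Rightarrow> 'r) set \<Rightarrow> bool"
  where "fun_submodule R K \<longleftrightarrow> K \<subseteq> UNIV \<rightarrow> carrier R \<and> (\<lambda>_. \<zero>\<^bsub>R\<^esub>) \<in> K \<and>
    (\<forall>k\<in>K. \<forall>k'\<in>K. (\<lambda>i. k i \<oplus>\<^bsub>R\<^esub> k' i) \<in> K) \<and>
    (\<forall>r\<in>carrier R. \<forall>k\<in>K. (\<lambda>i. r \<otimes>\<^bsub>R\<^esub> k i) \<in> K)"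

lemma pointwise_group_simps [simp]:
  "carrier (pointwise_group M) = UNIV \<rightarrow> carrier M"
  "v \<otimes>\<^bsub>pointwise_group M\<^esub> w = (\<lambda>i. v i \<oplus>\<^bsub>M\<^esub> w i)"
  "\<one>\<^bsub>pointwise_group M\<^esub> = (\<lambda>_. \<zero>\<^bsub>M\<^esub>)"
  by (simp_all add: pointwise_group_def)

lemma pointwise_comm_group:
  assumes "abelian_group M"
  shows "comm_group (pointwise_group M)"
proof -
  interpret M: abelian_group M by fact
  show ?thesis
  proof (rule comm_groupI)
    fix v assume "v \<in> carrier (pointwise_group M)"
    then show "\<exists>w\<in>carrier (pointwise_group M). w \<otimes>\<^bsub>pointwise_group M\<^esub> v = \<one>\<^bsub>pointwise_group M\<^esub>"
      by (intro bexI[of _ "\<lambda>i. \<ominus>\<^bsub>M\<^esub> v i"]) (auto simp: fun_eq_iff Pi_iff M.l_neg)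
  qed (auto simp: fun_eq_iff Pi_iff M.a_ac)
qed

lemma pointwise_inv:
  fixes v :: "'i \<Rightarrow> 'm"
  assumes "abelian_group M" "v \<in> UNIV \<rightarrow> carrier M"
  shows "inv\<^bsub>pointwise_group M\<^esub> v = (\<lambda>i. \<ominus>\<^bsub>M\<^esub> v i)"
proof -
  interpret M: abelian_group M by fact
  interpret G: comm_group "pointwise_group M :: ('i \<Rightarrow> _) monoid" by (rule pointwise_comm_group) fact
  show ?thesis
    by (rule G.inv_equality) (use assms(2) in \<open>auto simp: fun_eq_iff Pi_iff M.l_neg\<close>)
qed

lemma fun_submoduleD:
  assumes "fun_submodule R K"
  shows "k \<in> K \<Longrightarrow> k i \<in> carrier R"
    and "(\<lambda>_. \<zero>\<^bsub>R\<^esub>) \<in> K"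
    and "k \<in> K \<Longrightarrow> k' \<in> K \<Longrightarrow> (\<lambda>i. k i \<oplus>\<^bsub>R\<^esub> k' i) \<in> K"
    and "r \<in> carrier R \<Longrightarrow> k \<in> K \<Longrightarrow> (\<lambda>i. r \<otimes>\<^bsub>R\<^esub> k i) \<in> K"
  using assms unfolding fun_submodule_def by auto

lemma fun_submodule_diff:
  assumes "cring R" "fun_submodule R K" "k \<in> K" "k' \<in> K"
  shows "(\<lambda>i. k i \<ominus>\<^bsub>R\<^esub> k' i) \<in> K"
proof -
  interpret R: cring R by fact
  have "(\<lambda>i. \<ominus>\<^bsub>R\<^esub> \<one>\<^bsub>R\<^esub> \<otimes>\<^bsub>R\<^esub> k' i) \<in> K"
    by (rule fun_submoduleD(4)[OF assms(2) _ assms(4)]) simp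
  then have "(\<lambda>i. k i \<oplus>\<^bsub>R\<^esub> \<ominus>\<^bsub>R\<^esub> \<one>\<^bsub>R\<^esub> \<otimes>\<^bsub>R\<^esub> k' i) \<in> K"
    by (rule fun_submoduleD(3)[OF assms(2,3)])
  moreover have "k' i \<in> carrier R" for i
    by (rule fun_submoduleD(1)[OF assms(2,4)])
  ultimately show ?thesis by (simp add: R.l_minus a_minus_def)
qed

lemma pointwise_span_subgroup:
  fixes K :: "('i \<Rightarrow> 'r) set"
  assumes "module R M" "K \<subseteq> UNIV \<rightarrow> carrier R"
  shows "subgroup (pointwise_span K M) (pointwise_group M)"
proof -
  interpret M: module R M by fact
  interpret G: comm_group "pointwise_group M :: ('i \<Rightarrow> _) monoid"
    by (rule pointwise_comm_group) (rule M.abelian_group_axioms)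
  show ?thesis
    unfolding pointwise_span_def using assms(2) by (intro G.generate_is_subgroup) auto
qed

lemma pointwise_span_incl:
  "k \<in> K \<Longrightarrow> m \<in> carrier M \<Longrightarrow> (\<lambda>i. k i \<odot>\<^bsub>M\<^esub> m) \<in> pointwise_span K M"
  unfolding pointwise_span_def by (rule generate.incl, unfold mem_Collect_eq, intro exI conjI) (rule refl)

lemma pointwise_span_mono:
  fixes K :: "('i \<Rightarrow> 'r) set"
  assumes "module R M" "K \<subseteq> K'" "K' \<subseteq> UNIV \<rightarrow> carrier R"
  shows "pointwise_span K M \<subseteq> pointwise_span K' M"
proof -
  interpret M: module R M by fact
  interpret G: comm_group "pointwise_group M :: ('i \<Rightarrow> _) monoid"
    by (rule pointwise_comm_group) (rule M.abelian_group_axioms)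
  show ?thesis
    unfolding pointwise_span_def using assms by (intro G.mono_generate) auto
qed

section \<open>Flatness for ideals\<close>

text \<open>Keeps the carrier inside the type of \<open>R\<close>, where the flatness condition has
  its test modules; \<open>I = carrier R\<close> gives \<open>R\<close> as a module over
  itself.\<close>

definition ideal_module :: "('r, 'x) ring_scheme \<Rightarrow> 'r set \<Rightarrow> ('r, 'r) module"
  where "ideal_module R I = \<lparr>carrier = I, mult = undefined, one = undefined,
    ring.zero = \<zero>\<^bsub>R\<^esub>, add = (\<oplus>\<^bsub>R\<^esub>), smult = (\<otimes>\<^bsub>R\<^esub>)\<rparr>"

lemma ideal_module_simps [simp]:
  "carrier (ideal_module R I) = I"
  "x \<oplus>\<^bsub>ideal_module R I\<^esub> y = x \<oplus>\<^bsub>R\<^esub> y"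
  "\<zero>\<^bsub>ideal_module R I\<^esub> = \<zero>\<^bsub>R\<^esub>"
  "r \<odot>\<^bsub>ideal_module R I\<^esub> x = r \<otimes>\<^bsub>R\<^esub> x"
  by (simp_all add: ideal_module_def)

lemma module_ideal_module:
  assumes "cring R" "ideal I R"
  shows "module R (ideal_module R I)"
proof -
  interpret R: cring R by fact
  interpret I: ideal I R by fact
  have sub: "x \<in> I \<Longrightarrow> x \<in> carrier R" for x by (rule I.Icarr)
  show ?thesis
  proof (rule moduleI)
    show "abelian_group (ideal_module R I)"
    proof (rule abelian_groupI)
      fix x assume "x \<in> carrier (ideal_module R I)"
      then show "\<exists>y\<in>carrier (ideal_module R I). y \<oplus>\<^bsub>ideal_module R I\<^esub> x = \<zero>\<^bsub>ideal_module R I\<^esub>"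
        using sub by (auto intro!: bexI[of _ "\<ominus>\<^bsub>R\<^esub> x"] simp: R.l_neg)
    qed (use sub in \<open>auto simp: R.a_ac\<close>)
  qed (use sub assms(1) in \<open>auto simp: R.l_distr R.r_distr R.m_assoc I.I_l_closed\<close>)
qed

text \<open>Flatness for the inclusion of \<open>I\<close> into \<open>R\<close>: the cosets of
  \<open>a\<close> and of \<open>0\<close> over \<open>I\<close> have the same image, so injectivity
  makes them equal.\<close>

lemma flat_ideal_tensor_null:
  assumes "cring R" "flat_module R N" "ideal I R" "Poly_Mapping.keys a \<subseteq> I \<times> carrier N"
    and "a \<in> tensor_null R (ideal_module R (carrier R)) N"
  shows "a \<in> tensor_null R (ideal_module R I) N"
proof -
  interpret R: cring R by fact
  interpret I: ideal I R by fact
  let ?I = "ideal_module R I" and ?R = "ideal_module R (carrier R)"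
  let ?F = "free_Abelian_group (carrier ?I \<times> carrier N)"
  have mods: "module R ?I" "module R N" "module R ?R"
    using module_ideal_module[OF assms(1)] assms(2,3) R.oneideal by (auto simp: flat_module_def)
  have id: "(\<lambda>x. x) \<in> mod_hom R ?I ?R" "(\<lambda>x. x) \<in> mod_hom R N N"
    by (auto simp: mod_hom_def)
  have inj: "inj_on (tensor_map R ?R N (\<lambda>x. x) (\<lambda>y. y)) (carrier (tensor_group R ?I N))"
    by (rule assms(2)[unfolded flat_module_def, THEN conjunct2, rule_format, OF id(1)]) (use mods in auto)
  \<comment> \<open>The inclusion moves no basis element, so the induced map sends the coset of
    \<open>b\<close> over \<open>I\<close> to the coset of the same \<open>b\<close> over
    \<open>R\<close>.\<close>
  have expand: "frag_extend (\<lambda>(x, y). frag_of (x, y)) b = b" for b :: "('a \<times> 'c) \<Rightarrow>\<^sub>0 int"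
    using frag_expansion[of b] by (simp add: case_prod_unfold)
  have map: "tensor_map R ?R N (\<lambda>x. x) (\<lambda>y. y) (tensor_null R ?I N #>\<^bsub>?F\<^esub> b) = tensor_null R ?R N"
    if "Poly_Mapping.keys b \<subseteq> I \<times> carrier N" "b \<in> tensor_null R ?R N" for b
    using that tensor_map_coset[OF mods(1,2,3,2) id, of b] expand[of b]
      tensor_null_coset_eq[OF mods(3,2) tensor_null_closed(5)[OF mods(3,2)]] by simp
  have mem: "tensor_null R ?I N #>\<^bsub>?F\<^esub> b \<in> carrier (tensor_group R ?I N)"
    if "Poly_Mapping.keys b \<subseteq> I \<times> carrier N" for b
    using that unfolding tensor_group_def FactGroup_def RCOSETS_def by auto
  have "tensor_null R ?I N #>\<^bsub>?F\<^esub> a = tensor_null R ?I N #>\<^bsub>?F\<^esub> 0"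
  proof (rule inj_onD[OF inj])
    show "tensor_map R ?R N (\<lambda>x. x) (\<lambda>y. y) (tensor_null R ?I N #>\<^bsub>?F\<^esub> a) =
        tensor_map R ?R N (\<lambda>x. x) (\<lambda>y. y) (tensor_null R ?I N #>\<^bsub>?F\<^esub> 0)"
      using map[OF assms(4,5)] map[OF _ tensor_null_closed(1)[OF mods(3,2)]] by simp
  qed (rule mem, use assms(4) in simp)+
  also have "\<dots> = tensor_null R ?I N"
    using tensor_null_coset_eq[OF mods(1,2), of 0] tensor_null_closed(1)[OF mods(1,2)] by simp
  finally show ?thesis
    using tensor_null_coset_eq[OF mods(1,2), of a] assms(4) by simp
qed

section \<open>Submodules of functions and evaluation at a point\<close>

lemma fun_submodule_kernel:
  assumes "cring R" "fun_submodule R K"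
  shows "fun_submodule R {k \<in> K. k j = \<zero>\<^bsub>R\<^esub>}"
proof -
  interpret R: cring R by fact
  show ?thesis using assms(2) by (auto simp: fun_submodule_def)
qed

lemma fun_submodule_values_ideal:
  assumes "cring R" "fun_submodule R K"
  shows "ideal ((\<lambda>k. k j) ` K) R"
proof -
  interpret R: cring R by fact
  note K = fun_submoduleD[OF assms(2)]
  have mult: "r \<otimes>\<^bsub>R\<^esub> k j \<in> (\<lambda>k. k j) ` K" if "k \<in> K" "r \<in> carrier R" for k r
    using K(4)[OF that(2,1)] by (rule rev_image_eqI) simp
  show ?thesis
  proof (rule idealI[OF R.ring_axioms])
    show "subgroup ((\<lambda>k. k j) ` K) (add_monoid R)"
    proof (rule group.subgroupI[OF R.a_group])
      show "(\<lambda>k. k j) ` K \<subseteq> carrier (add_monoid R)" using K(1) by auto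
      show "(\<lambda>k. k j) ` K \<noteq> {}" using K(2) by blast
    next
      fix r assume "r \<in> (\<lambda>k. k j) ` K"
      then obtain k where k: "k \<in> K" "r = k j" by blast
      have "\<ominus>\<^bsub>R\<^esub> \<one>\<^bsub>R\<^esub> \<otimes>\<^bsub>R\<^esub> k j \<in> (\<lambda>k. k j) ` K"
        by (rule mult[OF k(1)]) simp
      then have "\<ominus>\<^bsub>R\<^esub> r \<in> (\<lambda>k. k j) ` K"
        using K(1)[OF k(1), of j] k(2) by (simp add: R.l_minus)
      then show "inv\<^bsub>add_monoid R\<^esub> r \<in> (\<lambda>k. k j) ` K" by (simp add: a_inv_def)
    next
      fix r r' assume "r \<in> (\<lambda>k. k j) ` K" "r' \<in> (\<lambda>k. k j) ` K"
      then obtain k k' where "k \<in> K" "r = k j" "k' \<in> K" "r' = k' j" by blast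
      then show "r \<otimes>\<^bsub>add_monoid R\<^esub> r' \<in> (\<lambda>k. k j) ` K"
        using K(3)[of k k'] by (intro rev_image_eqI[of "\<lambda>i. k i \<oplus>\<^bsub>R\<^esub> k' i"]) simp_all
    qed
  next
    fix a x assume "a \<in> (\<lambda>k. k j) ` K" "x \<in> carrier R"
    then show "x \<otimes>\<^bsub>R\<^esub> a \<in> (\<lambda>k. k j) ` K" "a \<otimes>\<^bsub>R\<^esub> x \<in> (\<lambda>k. k j) ` K"
      using mult K(1) by (auto simp: R.m_comm)
  qed
qed

text \<open>Splits off the error made when the coefficient \<open>b\<close> replaces
  \<open>a\<close>; in the maps constructed below that term lies in the subgroup of errors allowed
  by \<open>tensor_null_bilinear\<close>.\<close>

lemma (in module) smult_diff_add:
  assumes "a \<in> carrier R" "b \<in> carrier R" "m \<in> carrier M"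
  shows "a \<odot>\<^bsub>M\<^esub> m = (a \<ominus> b) \<odot>\<^bsub>M\<^esub> m \<oplus>\<^bsub>M\<^esub> b \<odot>\<^bsub>M\<^esub> m"
proof -
  have "a = (a \<ominus> b) \<oplus> b" using assms(1,2) by (simp add: a_minus_def R.a_assoc R.l_neg)
  then have "a \<odot>\<^bsub>M\<^esub> m = ((a \<ominus> b) \<oplus> b) \<odot>\<^bsub>M\<^esub> m" by (rule arg_cong)
  then show ?thesis using assms by (simp add: smult_l_distr)
qed

text \<open>
  With a section \<open>c\<close> of \<open>k \<mapsto> k j\<close> on the ideal \<open>I\<close> of values at \<open>j\<close>, an element \<open>\<Sum> k\<^sub>t m\<^sub>t\<close> vanishing
  at \<open>j\<close> differs from \<open>\<Sum> c(k\<^sub>t j) m\<^sub>t\<close> by an element of the smaller span, and flatness turns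
  \<open>\<Sum> k\<^sub>t j m\<^sub>t = 0\<close> into \<open>\<Sum> k\<^sub>t j \<otimes> m\<^sub>t = 0\<close> in \<open>I \<otimes> M\<close>.
\<close>

lemma flat_pointwise_span_kernel:
  fixes w :: "'i \<Rightarrow> 'm" and N :: "('r, 'm, 'y) module_scheme"
  assumes "cring R" "flat_module R N" "fun_submodule R K" "w \<in> pointwise_span K N" "w j = \<zero>\<^bsub>N\<^esub>"
  shows "w \<in> pointwise_span {k \<in> K. k j = \<zero>\<^bsub>R\<^esub>} N"
proof -
  have mN: "module R N" using assms(2) by (simp add: flat_module_def)
  interpret N: module R N by (rule mN)
  interpret G: comm_group "pointwise_group N :: ('i \<Rightarrow> 'm) monoid"
    by (rule pointwise_comm_group) (rule N.abelian_group_axioms)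
  let ?G = "pointwise_group N :: ('i \<Rightarrow> 'm) monoid"
  define K' where "K' = {k \<in> K. k j = \<zero>\<^bsub>R\<^esub>}"
  define I where "I = (\<lambda>k. k j) ` K"
  let ?I = "ideal_module R I" and ?R = "ideal_module R (carrier R)"
  note K = fun_submoduleD[OF assms(3)]
  have K': "fun_submodule R K'"
    unfolding K'_def by (rule fun_submodule_kernel[OF assms(1,3)])
  have I: "ideal I R"
    unfolding I_def by (rule fun_submodule_values_ideal[OF assms(1,3)])
  have mI: "module R ?I" and mR: "module R ?R"
    using module_ideal_module[OF assms(1)] I N.R.oneideal by auto
  let ?H = "pointwise_span K' N"
  have H: "subgroup ?H ?G"
    using K' by (intro pointwise_span_subgroup[OF mN]) (simp add: fun_submodule_def)
  interpret H: subgroup ?H ?G by (rule H)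
  \<comment> \<open>\<open>c\<close> is chosen value by value and need not be linear.\<close>
  obtain c where c: "\<And>r. r \<in> I \<Longrightarrow> c r \<in> K" "\<And>r. r \<in> I \<Longrightarrow> c r j = r"
    using bchoice[of I "\<lambda>r k. k \<in> K \<and> k j = r"] unfolding I_def by blast
  have cc: "c r i \<in> carrier R" if "r \<in> I" for r i by (rule K(1)[OF c(1)[OF that]])
  have IR: "r \<in> carrier R" if "r \<in> I" for r by (rule ideal.Icarr[OF I that])
  \<comment> \<open>Equal values at \<open>j\<close> put the difference \<open>k - k'\<close> into
    the kernel \<open>K'\<close>, so its multiples are errors in \<open>?H\<close>.\<close>
  have d: "(\<lambda>i. (k i \<ominus>\<^bsub>R\<^esub> k' i) \<odot>\<^bsub>N\<^esub> m) \<in> ?H"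
    if "k \<in> K" "k' \<in> K" "k j = k' j" "m \<in> carrier N" for k k' m
  proof (rule pointwise_span_incl[OF _ that(4)])
    show "(\<lambda>i. k i \<ominus>\<^bsub>R\<^esub> k' i) \<in> K'"
      using fun_submodule_diff[OF assms(1,3) that(1,2)] that(3) K(1)[OF that(2), of j]
      by (simp add: K'_def a_minus_def N.R.r_neg)
  qed
  \<comment> \<open>\<open>h\<close> lifts the map from \<open>I \<otimes> N\<close> to
    \<open>?G\<close> modulo \<open>?H\<close> that sends \<open>r \<otimes> m\<close> to the class
    of \<open>c r\<close> times \<open>m\<close>.\<close>
  have "\<exists>h \<in> hom (free_Abelian_group (carrier ?I \<times> carrier N)) ?G.
    (\<forall>r\<in>carrier ?I. \<forall>m\<in>carrier N. h (frag_of (r, m)) = (\<lambda>i. c r i \<odot>\<^bsub>N\<^esub> m)) \<and> h ` tensor_null R ?I N \<subseteq> ?H"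
  proof (rule tensor_null_bilinear[OF mI mN G.comm_group_axioms H, where f = "\<lambda>r m i. c r i \<odot>\<^bsub>N\<^esub> m"])
    fix r m assume "r \<in> carrier ?I" "m \<in> carrier N"
    then show "(\<lambda>i. c r i \<odot>\<^bsub>N\<^esub> m) \<in> carrier ?G" using cc by auto
  next
    fix r r' m assume r: "r \<in> carrier ?I" "r' \<in> carrier ?I" and m: "m \<in> carrier N"
    then have r: "r \<in> I" "r' \<in> I" by simp_all
    have rr: "r \<oplus>\<^bsub>R\<^esub> r' \<in> I" using module.axioms(2)[OF mI] r
      by (metis abelian_groupE(1) ideal_module_simps(1,2))
    \<comment> \<open>Both \<open>c (r + r')\<close> and \<open>?k'\<close> take the value
      \<open>r + r'\<close> at \<open>j\<close>, so \<open>d\<close> applies.\<close>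
    let ?k' = "\<lambda>i. c r i \<oplus>\<^bsub>R\<^esub> c r' i"
    have "(\<lambda>i. (c (r \<oplus>\<^bsub>R\<^esub> r') i \<ominus>\<^bsub>R\<^esub> ?k' i) \<odot>\<^bsub>N\<^esub> m) \<in> ?H"
      using c r rr K(3) m by (intro d) simp_all
    moreover have "c (r \<oplus>\<^bsub>R\<^esub> r') i \<odot>\<^bsub>N\<^esub> m =
      (c (r \<oplus>\<^bsub>R\<^esub> r') i \<ominus>\<^bsub>R\<^esub> ?k' i) \<odot>\<^bsub>N\<^esub> m \<oplus>\<^bsub>N\<^esub> (c r i \<odot>\<^bsub>N\<^esub> m \<oplus>\<^bsub>N\<^esub> c r' i \<odot>\<^bsub>N\<^esub> m)" for i
      using N.smult_diff_add[of "c (r \<oplus>\<^bsub>R\<^esub> r') i" "?k' i" m] cc r rr m by (simp add: N.smult_l_distr)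
    ultimately show "\<exists>d\<in>?H. (\<lambda>i. c (r \<oplus>\<^bsub>?I\<^esub> r') i \<odot>\<^bsub>N\<^esub> m) =
        d \<otimes>\<^bsub>?G\<^esub> ((\<lambda>i. c r i \<odot>\<^bsub>N\<^esub> m) \<otimes>\<^bsub>?G\<^esub> (\<lambda>i. c r' i \<odot>\<^bsub>N\<^esub> m))"
      unfolding pointwise_group_simps ideal_module_simps fun_eq_iff by (intro bexI allI)
  next
    fix r m m' assume "r \<in> carrier ?I" "m \<in> carrier N" "m' \<in> carrier N"
    then show "(\<lambda>i. c r i \<odot>\<^bsub>N\<^esub> (m \<oplus>\<^bsub>N\<^esub> m')) = (\<lambda>i. c r i \<odot>\<^bsub>N\<^esub> m) \<otimes>\<^bsub>?G\<^esub> (\<lambda>i. c r i \<odot>\<^bsub>N\<^esub> m')"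
      using cc by (simp add: N.smult_r_distr)
  next
    fix s r m assume s: "s \<in> carrier R" and r: "r \<in> carrier ?I" and m: "m \<in> carrier N"
    then have r: "r \<in> I" by simp
    have sr: "s \<otimes>\<^bsub>R\<^esub> r \<in> I" by (rule ideal.I_l_closed[OF I r s])
    \<comment> \<open>Here the common value at \<open>j\<close> is \<open>s r\<close>.\<close>
    let ?k' = "\<lambda>i. s \<otimes>\<^bsub>R\<^esub> c r i"
    have "(\<lambda>i. (c (s \<otimes>\<^bsub>R\<^esub> r) i \<ominus>\<^bsub>R\<^esub> ?k' i) \<odot>\<^bsub>N\<^esub> m) \<in> ?H"
      using c r sr K(4) m s by (intro d) simp_all
    moreover have "c (s \<otimes>\<^bsub>R\<^esub> r) i \<odot>\<^bsub>N\<^esub> m =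
      (c (s \<otimes>\<^bsub>R\<^esub> r) i \<ominus>\<^bsub>R\<^esub> ?k' i) \<odot>\<^bsub>N\<^esub> m \<oplus>\<^bsub>N\<^esub> c r i \<odot>\<^bsub>N\<^esub> (s \<odot>\<^bsub>N\<^esub> m)" for i
      using N.smult_diff_add[of "c (s \<otimes>\<^bsub>R\<^esub> r) i" "?k' i" m] cc r sr m s
        N.smult_assoc1[of "c r i" s m] N.R.m_comm[of s "c r i"] by simp
    ultimately show "\<exists>d\<in>?H. (\<lambda>i. c (s \<odot>\<^bsub>?I\<^esub> r) i \<odot>\<^bsub>N\<^esub> m) =
        d \<otimes>\<^bsub>?G\<^esub> (\<lambda>i. c r i \<odot>\<^bsub>N\<^esub> (s \<odot>\<^bsub>N\<^esub> m))"
      unfolding pointwise_group_simps ideal_module_simps fun_eq_iff by (intro bexI allI)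
  qed
  then obtain h where h: "h \<in> hom (free_Abelian_group (carrier ?I \<times> carrier N)) ?G"
    "\<And>r m. r \<in> carrier ?I \<Longrightarrow> m \<in> carrier N \<Longrightarrow> h (frag_of (r, m)) = (\<lambda>i. c r i \<odot>\<^bsub>N\<^esub> m)"
    "h ` tensor_null R ?I N \<subseteq> ?H"
    by blast
  interpret h: group_hom "free_Abelian_group (carrier ?I \<times> carrier N)" ?G h
    using h(1) by (simp add: group_hom_def group_hom_axioms_def)
  \<comment> \<open>\<open>a\<close> stands for
    \<open>\<Sum> k\<^sub>t j \<otimes> m\<^sub>t\<close>, kept as a formal sum over
    \<open>I\<close>. Over \<open>R\<close> it represents \<open>1 \<otimes> w j\<close>, while
    \<open>h a\<close> recovers \<open>w\<close> up to \<open>?H\<close>.\<close>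
  let ?P = "\<lambda>w. \<exists>a. Poly_Mapping.keys a \<subseteq> I \<times> carrier N \<and> w \<in> carrier ?G \<and>
    a - frag_of (\<one>\<^bsub>R\<^esub>, w j) \<in> tensor_null R ?R N \<and> (\<exists>v\<in>?H. w = v \<otimes>\<^bsub>?G\<^esub> h a)"
  have gen: "?P (\<lambda>i. k i \<odot>\<^bsub>N\<^esub> m)" if k: "k \<in> K" and m: "m \<in> carrier N" for k m
  proof (intro exI[of _ "frag_of (k j, m)"] conjI bexI)
    have kI: "k j \<in> I" using k by (auto simp: I_def)
    show "Poly_Mapping.keys (frag_of (k j, m)) \<subseteq> I \<times> carrier N" using kI m by simp
    show "(\<lambda>i. k i \<odot>\<^bsub>N\<^esub> m) \<in> carrier ?G" using K(1)[OF k] m by simp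
    \<comment> \<open>The balancing relator moves \<open>k j\<close> across
      \<open>1 \<otimes> m\<close>.\<close>
    show "frag_of (k j, m) - frag_of (\<one>\<^bsub>R\<^esub>, k j \<odot>\<^bsub>N\<^esub> m) \<in> tensor_null R ?R N"
      using tensor_null_relators(3)[of "\<one>\<^bsub>R\<^esub>" ?R "\<one>\<^bsub>R\<^esub>" m N m "k j" R] m K(1)[OF k] by simp
    show "(\<lambda>i. (k i \<ominus>\<^bsub>R\<^esub> c (k j) i) \<odot>\<^bsub>N\<^esub> m) \<in> ?H"
      using k m c kI by (intro d) simp_all
    show "(\<lambda>i. k i \<odot>\<^bsub>N\<^esub> m) = (\<lambda>i. (k i \<ominus>\<^bsub>R\<^esub> c (k j) i) \<odot>\<^bsub>N\<^esub> m) \<otimes>\<^bsub>?G\<^esub> h (frag_of (k j, m))"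
      using h(2)[of "k j" m] kI m N.smult_diff_add[OF K(1)[OF k] cc[OF kI] m] by simp
  qed
  from assms(4)[unfolded pointwise_span_def] have "?P w"
  proof (induction w rule: generate.induct)
    case one
    show ?case
    proof (intro exI[of _ 0] conjI bexI)
      show "0 - frag_of (\<one>\<^bsub>R\<^esub>, \<one>\<^bsub>?G\<^esub> j) \<in> tensor_null R ?R N"
        using tensor_null_zero(1)[OF mR mN, of "\<one>\<^bsub>R\<^esub>" "\<zero>\<^bsub>N\<^esub>"] tensor_null_closed(3)[OF mR mN] by simp
      show "\<one>\<^bsub>?G\<^esub> \<in> ?H" by (rule H.one_closed)
      show "\<one>\<^bsub>?G\<^esub> = \<one>\<^bsub>?G\<^esub> \<otimes>\<^bsub>?G\<^esub> h 0" using h.hom_one by simp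
    qed simp_all
  next
    case (incl w)
    then show ?case using gen by blast
  next
    case (inv w)
    then obtain k m where k: "k \<in> K" "m \<in> carrier N" "w = (\<lambda>i. k i \<odot>\<^bsub>N\<^esub> m)" by blast
    \<comment> \<open>The inverse of a generator is again a generator, with \<open>- m\<close> in
      place of \<open>m\<close>.\<close>
    then have "inv\<^bsub>?G\<^esub> w = (\<lambda>i. k i \<odot>\<^bsub>N\<^esub> \<ominus>\<^bsub>N\<^esub> m)"
      using K(1)[OF k(1)] by (simp add: pointwise_inv[OF N.abelian_group_axioms] N.smult_r_minus)
    then show ?case using gen[OF k(1), of "\<ominus>\<^bsub>N\<^esub> m"] k(2) by simp
  next
    case (eng w w')
    obtain a v where a: "Poly_Mapping.keys a \<subseteq> I \<times> carrier N" "w \<in> carrier ?G"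
      "a - frag_of (\<one>\<^bsub>R\<^esub>, w j) \<in> tensor_null R ?R N" "v \<in> ?H" "w = v \<otimes>\<^bsub>?G\<^esub> h a" using eng.IH(1) by blast
    obtain a' v' where a': "Poly_Mapping.keys a' \<subseteq> I \<times> carrier N" "w' \<in> carrier ?G"
      "a' - frag_of (\<one>\<^bsub>R\<^esub>, w' j) \<in> tensor_null R ?R N" "v' \<in> ?H" "w' = v' \<otimes>\<^bsub>?G\<^esub> h a'" using eng.IH(2) by blast
    have wj: "w j \<in> carrier N" "w' j \<in> carrier N" using a(2) a'(2) by auto
    show ?case
    proof (intro exI[of _ "a + a'"] conjI bexI)
      show "Poly_Mapping.keys (a + a') \<subseteq> I \<times> carrier N" by (rule keys_add_subset[OF a(1) a'(1)])
      show "w \<otimes>\<^bsub>?G\<^esub> w' \<in> carrier ?G" using a(2) a'(2) by (rule G.m_closed)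
      \<comment> \<open>Subtracting the additivity relator merges \<open>1 \<otimes> w j\<close> and
        \<open>1 \<otimes> w' j\<close> into one term.\<close>
      have "(a - frag_of (\<one>\<^bsub>R\<^esub>, w j)) + (a' - frag_of (\<one>\<^bsub>R\<^esub>, w' j)) -
        (frag_of (\<one>\<^bsub>R\<^esub>, w j \<oplus>\<^bsub>N\<^esub> w' j) - (frag_of (\<one>\<^bsub>R\<^esub>, w j) + frag_of (\<one>\<^bsub>R\<^esub>, w' j))) \<in> tensor_null R ?R N"
        using wj by (intro tensor_null_closed(2,4)[OF mR mN] a(3) a'(3) tensor_null_relators(2)[where x' = "\<one>\<^bsub>R\<^esub>" and r = "\<one>\<^bsub>R\<^esub>"]) simp_all
      then show "a + a' - frag_of (\<one>\<^bsub>R\<^esub>, (w \<otimes>\<^bsub>?G\<^esub> w') j) \<in> tensor_null R ?R N"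
        by (simp add: algebra_simps)
      show "v \<otimes>\<^bsub>?G\<^esub> v' \<in> ?H" using a(4) a'(4) by (rule H.m_closed)
      have ha: "h a \<in> carrier ?G" "h a' \<in> carrier ?G" "h (a + a') = h a \<otimes>\<^bsub>?G\<^esub> h a'"
        using a(1) a'(1) h.hom_closed h.hom_mult[of a a'] by simp_all
      show "w \<otimes>\<^bsub>?G\<^esub> w' = v \<otimes>\<^bsub>?G\<^esub> v' \<otimes>\<^bsub>?G\<^esub> h (a + a')"
        unfolding a(5) a'(5) ha(3) using ha(1,2) H.mem_carrier[OF a(4)] H.mem_carrier[OF a'(4)]
        by (simp only: G.m_ac G.m_closed)
    qed
  qed
  then obtain a v where a: "Poly_Mapping.keys a \<subseteq> I \<times> carrier N"
    "a - frag_of (\<one>\<^bsub>R\<^esub>, w j) \<in> tensor_null R ?R N" "v \<in> ?H" "w = v \<otimes>\<^bsub>?G\<^esub> h a" by blast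
  \<comment> \<open>The vanishing of \<open>w\<close> at \<open>j\<close> enters here:
    \<open>1 \<otimes> w j = 0\<close>, so \<open>a\<close> is null over \<open>R\<close>, and
    flatness makes it null over \<open>I\<close>.\<close>
  have "frag_of (\<one>\<^bsub>R\<^esub>, w j) \<in> tensor_null R ?R N"
    unfolding assms(5) using tensor_null_zero(1)[OF mR mN, of "\<one>\<^bsub>R\<^esub>" "\<zero>\<^bsub>N\<^esub>"] by simp
  then have "a \<in> tensor_null R ?R N"
    using tensor_null_closed(2)[OF mR mN a(2), of "frag_of (\<one>\<^bsub>R\<^esub>, w j)"] by simp
  then have "a \<in> tensor_null R ?I N"
    by (rule flat_ideal_tensor_null[OF assms(1,2) I a(1)])
  then have "h a \<in> ?H" using h(3) by blast
  then show ?thesis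
    unfolding K'_def[symmetric] a(4) by (rule H.m_closed[OF a(3)])
qed

section \<open>Vanishing of pure tensors\<close>

text \<open>Linear relations in which each element of \<open>Y\<close> serves as its own index. The
  zero values outside \<open>Y\<close> let the relations for different \<open>Y\<close> be compared
  as functions on one type.\<close>

definition syzygies :: "('r, 'x) ring_scheme \<Rightarrow> ('r, 'l, 'y) module_scheme \<Rightarrow> 'l set \<Rightarrow> ('l \<Rightarrow> 'r) set"
  where "syzygies R L Y = {k \<in> UNIV \<rightarrow> carrier R.
    (\<forall>i. i \<notin> Y \<longrightarrow> k i = \<zero>\<^bsub>R\<^esub>) \<and> (\<Oplus>\<^bsub>L\<^esub>i\<in>Y. k i \<odot>\<^bsub>L\<^esub> i) = \<zero>\<^bsub>L\<^esub>}"

lemma fun_submodule_syzygies: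
  assumes "module R L" "finite Y" "Y \<subseteq> carrier L"
  shows "fun_submodule R (syzygies R L Y)"
proof -
  interpret L: module R L by fact
  have Y: "i \<in> carrier L" if "i \<in> Y" for i using assms(3) that by blast
  show ?thesis
    unfolding fun_submodule_def
  proof (intro conjI ballI)
    show "syzygies R L Y \<subseteq> UNIV \<rightarrow> carrier R" by (auto simp: syzygies_def)
    have "(\<Oplus>\<^bsub>L\<^esub>i\<in>Y. \<zero>\<^bsub>R\<^esub> \<odot>\<^bsub>L\<^esub> i) = \<zero>\<^bsub>L\<^esub>"
      using Y by (intro L.M.add.finprod_one_eqI) auto
    then show "(\<lambda>_. \<zero>\<^bsub>R\<^esub>) \<in> syzygies R L Y" by (simp add: syzygies_def)
  next
    fix k k' assume "k \<in> syzygies R L Y" "k' \<in> syzygies R L Y"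
    then have k: "\<And>i. k i \<in> carrier R" "\<And>i. i \<notin> Y \<Longrightarrow> k i = \<zero>\<^bsub>R\<^esub>" "(\<Oplus>\<^bsub>L\<^esub>i\<in>Y. k i \<odot>\<^bsub>L\<^esub> i) = \<zero>\<^bsub>L\<^esub>"
      and k': "\<And>i. k' i \<in> carrier R" "\<And>i. i \<notin> Y \<Longrightarrow> k' i = \<zero>\<^bsub>R\<^esub>" "(\<Oplus>\<^bsub>L\<^esub>i\<in>Y. k' i \<odot>\<^bsub>L\<^esub> i) = \<zero>\<^bsub>L\<^esub>"
      by (auto simp: syzygies_def)
    have "(\<Oplus>\<^bsub>L\<^esub>i\<in>Y. (k i \<oplus>\<^bsub>R\<^esub> k' i) \<odot>\<^bsub>L\<^esub> i) = (\<Oplus>\<^bsub>L\<^esub>i\<in>Y. k i \<odot>\<^bsub>L\<^esub> i \<oplus>\<^bsub>L\<^esub> k' i \<odot>\<^bsub>L\<^esub> i)"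
      using k(1) k'(1) Y by (intro L.M.finsum_cong) (auto simp: L.smult_l_distr simp_implies_def)
    also have "\<dots> = \<zero>\<^bsub>L\<^esub>"
      using k k' Y by (subst L.M.finsum_addf) auto
    finally show "(\<lambda>i. k i \<oplus>\<^bsub>R\<^esub> k' i) \<in> syzygies R L Y"
      using k k' by (simp add: syzygies_def)
  next
    fix r k assume r: "r \<in> carrier R" and "k \<in> syzygies R L Y"
    then have k: "\<And>i. k i \<in> carrier R" "\<And>i. i \<notin> Y \<Longrightarrow> k i = \<zero>\<^bsub>R\<^esub>" "(\<Oplus>\<^bsub>L\<^esub>i\<in>Y. k i \<odot>\<^bsub>L\<^esub> i) = \<zero>\<^bsub>L\<^esub>"
      by (auto simp: syzygies_def)
    have "(\<Oplus>\<^bsub>L\<^esub>i\<in>Y. (r \<otimes>\<^bsub>R\<^esub> k i) \<odot>\<^bsub>L\<^esub> i) = (\<Oplus>\<^bsub>L\<^esub>i\<in>Y. r \<odot>\<^bsub>L\<^esub> (k i \<odot>\<^bsub>L\<^esub> i))"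
      using k(1) r Y by (intro L.M.finsum_cong) (auto simp: L.smult_assoc1 simp_implies_def)
    also have "\<dots> = r \<odot>\<^bsub>L\<^esub> (\<Oplus>\<^bsub>L\<^esub>i\<in>Y. k i \<odot>\<^bsub>L\<^esub> i)"
      using k(1) r Y assms(2) by (subst L.finsum_smult_ldistr) auto
    finally show "(\<lambda>i. r \<otimes>\<^bsub>R\<^esub> k i) \<in> syzygies R L Y"
      using k r by (simp add: syzygies_def)
  qed
qed

lemma syzygies_mono:
  assumes "module R L" "finite Y'" "Y' \<subseteq> carrier L" "Y \<subseteq> Y'"
  shows "syzygies R L Y \<subseteq> syzygies R L Y'"
proof
  interpret L: module R L by fact
  fix k assume k: "k \<in> syzygies R L Y"
  have "(\<Oplus>\<^bsub>L\<^esub>i\<in>Y. k i \<odot>\<^bsub>L\<^esub> i) = (\<Oplus>\<^bsub>L\<^esub>i\<in>Y'. k i \<odot>\<^bsub>L\<^esub> i)"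
    using k assms(2-4) unfolding syzygies_def
    by (intro L.M.add.finprod_mono_neutral_cong_left) (auto intro!: L.smult_closed)
  then show "k \<in> syzygies R L Y'"
    using k assms(4) by (auto simp: syzygies_def)
qed

lemma syzygies_diff:
  assumes "module R L" "finite Y" "Y \<subseteq> carrier L" "k \<in> UNIV \<rightarrow> carrier R" "k' \<in> UNIV \<rightarrow> carrier R"
    and "\<And>i. i \<notin> Y \<Longrightarrow> k i = k' i" "(\<Oplus>\<^bsub>L\<^esub>i\<in>Y. k i \<odot>\<^bsub>L\<^esub> i) = (\<Oplus>\<^bsub>L\<^esub>i\<in>Y. k' i \<odot>\<^bsub>L\<^esub> i)"
  shows "(\<lambda>i. k i \<ominus>\<^bsub>R\<^esub> k' i) \<in> syzygies R L Y"
proof -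
  interpret L: module R L by fact
  have k: "k i \<in> carrier R" "k' i \<in> carrier R" for i using assms(4,5) by auto
  have Y: "i \<in> carrier L" if "i \<in> Y" for i using assms(3) that by blast
  \<comment> \<open>Writing \<open>k\<close> as \<open>(k - k') + k'\<close> turns the equality of
    the two sums into a cancellation.\<close>
  have "(\<Oplus>\<^bsub>L\<^esub>i\<in>Y. k i \<odot>\<^bsub>L\<^esub> i) = (\<Oplus>\<^bsub>L\<^esub>i\<in>Y. (k i \<ominus>\<^bsub>R\<^esub> k' i) \<odot>\<^bsub>L\<^esub> i \<oplus>\<^bsub>L\<^esub> k' i \<odot>\<^bsub>L\<^esub> i)"
    using k Y by (intro L.M.finsum_cong) (auto simp: simp_implies_def L.smult_diff_add[symmetric])
  also have "\<dots> = (\<Oplus>\<^bsub>L\<^esub>i\<in>Y. (k i \<ominus>\<^bsub>R\<^esub> k' i) \<odot>\<^bsub>L\<^esub> i) \<oplus>\<^bsub>L\<^esub> (\<Oplus>\<^bsub>L\<^esub>i\<in>Y. k' i \<odot>\<^bsub>L\<^esub> i)"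
    using k Y by (intro L.M.finsum_addf) auto
  finally have "(\<Oplus>\<^bsub>L\<^esub>i\<in>Y. (k i \<ominus>\<^bsub>R\<^esub> k' i) \<odot>\<^bsub>L\<^esub> i) = \<zero>\<^bsub>L\<^esub>"
    unfolding assms(7) using k Y L.M.add.l_cancel_one'[of "\<Oplus>\<^bsub>L\<^esub>i\<in>Y. k' i \<odot>\<^bsub>L\<^esub> i" "\<Oplus>\<^bsub>L\<^esub>i\<in>Y. (k i \<ominus>\<^bsub>R\<^esub> k' i) \<odot>\<^bsub>L\<^esub> i"]
    by (auto simp: L.M.finsum_closed)
  then show ?thesis
    using k assms(6) by (auto simp: syzygies_def a_minus_def L.R.r_neg)
qed

text \<open>Through this the basis functions at \<open>y\<close>, \<open>y'\<close> and
  \<open>y + y'\<close> have comparable sums in \<open>L\<close>, so that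
  \<open>syzygies_diff\<close> applies to them.\<close>

lemma finsum_indicator_smult:
  assumes "module R L" "finite Y" "Y \<subseteq> carrier L" "y \<in> Y"
  shows "(\<Oplus>\<^bsub>L\<^esub>i\<in>Y. (if i = y then \<one>\<^bsub>R\<^esub> else \<zero>\<^bsub>R\<^esub>) \<odot>\<^bsub>L\<^esub> i) = y"
proof -
  interpret L: module R L by fact
  have "(\<Oplus>\<^bsub>L\<^esub>i\<in>Y. (if i = y then \<one>\<^bsub>R\<^esub> else \<zero>\<^bsub>R\<^esub>) \<odot>\<^bsub>L\<^esub> i) = (\<Oplus>\<^bsub>L\<^esub>i\<in>Y. if i = y then i else \<zero>\<^bsub>L\<^esub>)"
    using assms(3) by (intro L.M.finsum_cong) (auto simp: simp_implies_def)
  also have "\<dots> = y"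
    using assms by (intro L.M.add.finprod_singleton_swap) auto
  finally show ?thesis .
qed

section \<open>Subgroups generated by the multiples with scalars from a given set\<close>

lemma ideal_smult_subgroup:
  assumes "module R N" "A \<subseteq> carrier R"
  shows "subgroup (ideal_smult A N) (add_monoid N)"
proof -
  interpret N: module R N by fact
  show ?thesis
    unfolding ideal_smult_def using assms(2) by (intro N.M.add.generate_is_subgroup) auto
qed

lemma ideal_smult_mono:
  assumes "module R N" "A \<subseteq> B" "B \<subseteq> carrier R"
  shows "ideal_smult A N \<subseteq> ideal_smult B N"
proof -
  interpret N: module R N by fact
  show ?thesis
    unfolding ideal_smult_def using assms(2,3) by (intro N.M.add.mono_generate) auto
qed

text \<open>This is where finitely generated ideals become available: an element built from
  generators involves only finitely many scalars.\<close>

lemma ideal_smult_finite: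
  assumes "module R N" "A \<subseteq> carrier R" "u \<in> ideal_smult A N"
  shows "\<exists>B. finite B \<and> B \<subseteq> A \<and> u \<in> ideal_smult B N"
  using assms(3) unfolding ideal_smult_def[of A]
proof (induction u rule: generate.induct)
  case one
  have "\<one>\<^bsub>add_monoid N\<^esub> \<in> ideal_smult {} N" unfolding ideal_smult_def by (rule generate.one)
  then show ?case by blast
next
  case (incl u)
  then obtain a x where "a \<in> A" "x \<in> carrier N" "u = a \<odot>\<^bsub>N\<^esub> x" by blast
  then have "u \<in> ideal_smult {a} N" unfolding ideal_smult_def by (intro generate.incl) blast
  with \<open>a \<in> A\<close> show ?case by (intro exI[of _ "{a}"]) simp
next
  case (inv u)
  then obtain a x where "a \<in> A" "x \<in> carrier N" "u = a \<odot>\<^bsub>N\<^esub> x" by blast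
  then have "inv\<^bsub>add_monoid N\<^esub> u \<in> ideal_smult {a} N" unfolding ideal_smult_def by (intro generate.inv) blast
  with \<open>a \<in> A\<close> show ?case by (intro exI[of _ "{a}"]) simp
next
  case (eng u v)
  then obtain B C where B: "finite B" "B \<subseteq> A" "u \<in> ideal_smult B N" and C: "finite C" "C \<subseteq> A" "v \<in> ideal_smult C N"
    by blast
  have "u \<in> ideal_smult (B \<union> C) N" "v \<in> ideal_smult (B \<union> C) N"
    using ideal_smult_mono[OF assms(1), of _ "B \<union> C"] B C assms(2) by blast+
  then have "u \<otimes>\<^bsub>add_monoid N\<^esub> v \<in> ideal_smult (B \<union> C) N"
    unfolding ideal_smult_def by (rule generate.eng)
  then show ?case using B(1,2) C(1,2) by (intro exI[of _ "B \<union> C"]) simp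
qed

lemma annihilator_carrier: "annihilator R L l \<subseteq> carrier R"
  by (auto simp: annihilator_def)

text \<open>Balancing gives \<open>l \<otimes> a m = a l \<otimes> m = 0 \<otimes> m\<close>, and
  additivity passes this on to sums.\<close>

lemma tensor_null_if_annihilated:
  assumes "module R L" "module R N" "l \<in> carrier L" "x \<in> ideal_smult (annihilator R L l) N"
  shows "frag_of (l, x) \<in> tensor_null R L N"
proof -
  interpret L: module R L by fact
  interpret N: module R N by fact
  have gen: "frag_of (l, a \<odot>\<^bsub>N\<^esub> m) \<in> tensor_null R L N" if "a \<in> annihilator R L l" "m \<in> carrier N" for a m
  proof -
    have a: "a \<in> carrier R" "a \<odot>\<^bsub>L\<^esub> l = \<zero>\<^bsub>L\<^esub>" using that(1) by (auto simp: annihilator_def)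
    have "frag_of (\<zero>\<^bsub>L\<^esub>, m) - (frag_of (a \<odot>\<^bsub>L\<^esub> l, m) - frag_of (l, a \<odot>\<^bsub>N\<^esub> m)) \<in> tensor_null R L N"
      using tensor_null_zero(2)[OF assms(1,2,3) that(2)] tensor_null_relators(3)[OF assms(3,3) that(2,2) a(1)]
      by (rule tensor_null_closed(4)[OF assms(1,2)])
    then show ?thesis using a(2) by simp
  qed
  \<comment> \<open>Membership in the carrier is carried through the induction because the
    additivity relator asks for it.\<close>
  have "x \<in> carrier N \<and> frag_of (l, x) \<in> tensor_null R L N"
    using assms(4) unfolding ideal_smult_def
  proof (induction x rule: generate.induct)
    case one
    then show ?case using tensor_null_zero(1)[OF assms(1-3) N.M.zero_closed] by simp
  next
    case (incl u)
    then show ?case using gen by (auto simp: annihilator_def)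
  next
    case (inv u)
    then obtain a m where a: "a \<in> annihilator R L l" "m \<in> carrier N" "u = a \<odot>\<^bsub>N\<^esub> m" by blast
    then have "inv\<^bsub>add_monoid N\<^esub> u = a \<odot>\<^bsub>N\<^esub> (\<ominus>\<^bsub>N\<^esub> m)"
      by (simp add: N.smult_r_minus annihilator_def a_inv_def[symmetric])
    then show ?case using gen[OF a(1), of "\<ominus>\<^bsub>N\<^esub> m"] a(1,2) by (auto simp: annihilator_def)
  next
    case (eng u v)
    have "(frag_of (l, u \<oplus>\<^bsub>N\<^esub> v) - (frag_of (l, u) + frag_of (l, v))) + (frag_of (l, u) + frag_of (l, v))
        \<in> tensor_null R L N"
      using eng.IH assms(3)
      by (intro tensor_null_closed(2)[OF assms(1,2)] tensor_null_relators(2)[where x' = l and r = "\<zero>\<^bsub>R\<^esub>"]) auto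
    then show ?case using eng.IH by simp
  qed
  then show ?thesis by simp
qed

text \<open>A form of the equational criterion for flatness, for the single relation
  \<open>l \<otimes> x = 0\<close>. Elements of \<open>L\<close> index functions and relations, so
  that flatness is applied only to ideals of \<open>R\<close>.\<close>

lemma flat_annihilated_if_tensor_null:
  fixes L :: "('r, 'l, 'y) module_scheme" and N :: "('r, 'm, 'z) module_scheme"
  assumes "module R L" "flat_module R N" "l \<in> carrier L" "x \<in> carrier N"
    and "frag_of (l, x) \<in> tensor_null R L N"
  shows "x \<in> ideal_smult (annihilator R L l) N"
proof -
  have mN: "module R N" using assms(2) by (simp add: flat_module_def)
  interpret L: module R L by fact
  interpret N: module R N by (rule mN)
  interpret G: comm_group "pointwise_group N :: ('l \<Rightarrow> 'm) monoid"
    by (rule pointwise_comm_group) (rule N.abelian_group_axioms)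
  let ?G = "pointwise_group N :: ('l \<Rightarrow> 'm) monoid"
  \<comment> \<open>\<open>?\<delta> y\<close> is the basis vector at \<open>y\<close> of the free
    module on the elements of \<open>L\<close>.\<close>
  let ?\<delta> = "\<lambda>y i. if i = y then \<one>\<^bsub>R\<^esub> else \<zero>\<^bsub>R\<^esub>"
  let ?fin = "\<lambda>Y. finite Y \<and> Y \<subseteq> carrier L"
  define H where "H = (\<Union>Y\<in>Collect ?fin. pointwise_span (syzygies R L Y) N)"
  have sub: "fun_submodule R (syzygies R L Y)" if "?fin Y" for Y
    using that fun_submodule_syzygies[OF assms(1)] by blast
  have R: "syzygies R L Y \<subseteq> UNIV \<rightarrow> carrier R" for Y by (auto simp: syzygies_def)
  note subg = pointwise_span_subgroup[OF mN R]
  have mono: "pointwise_span (syzygies R L Y) N \<subseteq> pointwise_span (syzygies R L Y') N"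
    if "?fin Y'" "Y \<subseteq> Y'" for Y Y'
    using that syzygies_mono[OF assms(1)] by (intro pointwise_span_mono[OF mN _ R]) blast
  have H: "subgroup H ?G"
  proof (rule G.subgroupI)
    show "H \<subseteq> carrier ?G" using subgroup.subset[OF subg] unfolding H_def by blast
    have "\<one>\<^bsub>?G\<^esub> \<in> pointwise_span (syzygies R L {}) N" by (rule subgroup.one_closed[OF subg])
    then show "H \<noteq> {}" unfolding H_def by blast
  next
    fix v assume "v \<in> H"
    then show "inv\<^bsub>?G\<^esub> v \<in> H" unfolding H_def using subgroup.m_inv_closed[OF subg] by blast
  next
    fix v w assume "v \<in> H" "w \<in> H"
    then obtain Y Z where Y: "?fin Y" "v \<in> pointwise_span (syzygies R L Y) N"
      and Z: "?fin Z" "w \<in> pointwise_span (syzygies R L Z) N" unfolding H_def by blast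
    \<comment> \<open>The family of spans is directed: two of them lie in the span for
      \<open>Y \<union> Z\<close>.\<close>
    have YZ: "?fin (Y \<union> Z)" using Y(1) Z(1) by blast
    have "v \<in> pointwise_span (syzygies R L (Y \<union> Z)) N" "w \<in> pointwise_span (syzygies R L (Y \<union> Z)) N"
      using mono[OF YZ] Y(2) Z(2) by blast+
    then have "v \<otimes>\<^bsub>?G\<^esub> w \<in> pointwise_span (syzygies R L (Y \<union> Z)) N"
      by (rule subgroup.m_closed[OF subg])
    then show "v \<otimes>\<^bsub>?G\<^esub> w \<in> H" unfolding H_def using YZ by blast
  qed
  \<comment> \<open>Coefficient functions with the same sum in \<open>L\<close> are interchangeable
    modulo \<open>H\<close>.\<close>
  have d: "(\<lambda>i. (k i \<ominus>\<^bsub>R\<^esub> k' i) \<odot>\<^bsub>N\<^esub> m) \<in> H"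
    if "?fin Y" "k \<in> UNIV \<rightarrow> carrier R" "k' \<in> UNIV \<rightarrow> carrier R" "\<And>i. i \<notin> Y \<Longrightarrow> k i = k' i"
      "(\<Oplus>\<^bsub>L\<^esub>i\<in>Y. k i \<odot>\<^bsub>L\<^esub> i) = (\<Oplus>\<^bsub>L\<^esub>i\<in>Y. k' i \<odot>\<^bsub>L\<^esub> i)" "m \<in> carrier N" for Y k k' m
    using pointwise_span_incl[OF syzygies_diff[OF assms(1) _ _ that(2-5)] that(6)] that(1)
    unfolding H_def by blast
  \<comment> \<open>\<open>h\<close> lifts the map from \<open>L \<otimes> N\<close> to
    \<open>?G\<close> modulo \<open>H\<close> given by
    \<open>y \<otimes> m \<mapsto> \<delta>\<^sub>y m\<close>.\<close>
  have "\<exists>h \<in> hom (free_Abelian_group (carrier L \<times> carrier N)) ?G.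
    (\<forall>y\<in>carrier L. \<forall>m\<in>carrier N. h (frag_of (y, m)) = (\<lambda>i. ?\<delta> y i \<odot>\<^bsub>N\<^esub> m)) \<and> h ` tensor_null R L N \<subseteq> H"
  proof (rule tensor_null_bilinear[OF assms(1) mN G.comm_group_axioms H, where f = "\<lambda>y m i. ?\<delta> y i \<odot>\<^bsub>N\<^esub> m"])
    fix y m assume "y \<in> carrier L" "m \<in> carrier N"
    then show "(\<lambda>i. ?\<delta> y i \<odot>\<^bsub>N\<^esub> m) \<in> carrier ?G" by auto
  next
    fix y y' m assume y: "y \<in> carrier L" "y' \<in> carrier L" and m: "m \<in> carrier N"
    \<comment> \<open>\<open>?Y\<close> covers the supports of all three basis functions; being a
      set it tolerates coincidences such as \<open>y = y'\<close>.\<close>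
    let ?Y = "{y, y', y \<oplus>\<^bsub>L\<^esub> y'}" and ?k' = "\<lambda>i. ?\<delta> y i \<oplus>\<^bsub>R\<^esub> ?\<delta> y' i"
    have Y: "finite ?Y" "?Y \<subseteq> carrier L" using y by auto
    have "(\<Oplus>\<^bsub>L\<^esub>i\<in>?Y. ?k' i \<odot>\<^bsub>L\<^esub> i) = (\<Oplus>\<^bsub>L\<^esub>i\<in>?Y. ?\<delta> y i \<odot>\<^bsub>L\<^esub> i \<oplus>\<^bsub>L\<^esub> ?\<delta> y' i \<odot>\<^bsub>L\<^esub> i)"
      using Y(2) by (intro L.M.finsum_cong refl) (auto simp: L.smult_l_distr simp_implies_def)
    also have "\<dots> = (\<Oplus>\<^bsub>L\<^esub>i\<in>?Y. ?\<delta> y i \<odot>\<^bsub>L\<^esub> i) \<oplus>\<^bsub>L\<^esub> (\<Oplus>\<^bsub>L\<^esub>i\<in>?Y. ?\<delta> y' i \<odot>\<^bsub>L\<^esub> i)"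
      using Y(2) by (intro L.M.finsum_addf) auto
    also have "\<dots> = (\<Oplus>\<^bsub>L\<^esub>i\<in>?Y. ?\<delta> (y \<oplus>\<^bsub>L\<^esub> y') i \<odot>\<^bsub>L\<^esub> i)"
      by (simp only: finsum_indicator_smult[OF assms(1) Y] insert_iff simp_thms)
    finally have "(\<lambda>i. (?\<delta> (y \<oplus>\<^bsub>L\<^esub> y') i \<ominus>\<^bsub>R\<^esub> ?k' i) \<odot>\<^bsub>N\<^esub> m) \<in> H"
      using m Y by (intro d[of ?Y]) auto
    moreover have "?\<delta> (y \<oplus>\<^bsub>L\<^esub> y') i \<odot>\<^bsub>N\<^esub> m =
      (?\<delta> (y \<oplus>\<^bsub>L\<^esub> y') i \<ominus>\<^bsub>R\<^esub> ?k' i) \<odot>\<^bsub>N\<^esub> m \<oplus>\<^bsub>N\<^esub> (?\<delta> y i \<odot>\<^bsub>N\<^esub> m \<oplus>\<^bsub>N\<^esub> ?\<delta> y' i \<odot>\<^bsub>N\<^esub> m)" for i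
      by (subst N.smult_l_distr[symmetric], simp, simp, fact m, rule N.smult_diff_add) (use m in auto)
    ultimately show "\<exists>d\<in>H. (\<lambda>i. ?\<delta> (y \<oplus>\<^bsub>L\<^esub> y') i \<odot>\<^bsub>N\<^esub> m) =
        d \<otimes>\<^bsub>?G\<^esub> ((\<lambda>i. ?\<delta> y i \<odot>\<^bsub>N\<^esub> m) \<otimes>\<^bsub>?G\<^esub> (\<lambda>i. ?\<delta> y' i \<odot>\<^bsub>N\<^esub> m))"
      unfolding pointwise_group_simps fun_eq_iff by (intro bexI allI)
  next
    fix y m m' assume "y \<in> carrier L" "m \<in> carrier N" "m' \<in> carrier N"
    then show "(\<lambda>i. ?\<delta> y i \<odot>\<^bsub>N\<^esub> (m \<oplus>\<^bsub>N\<^esub> m')) = (\<lambda>i. ?\<delta> y i \<odot>\<^bsub>N\<^esub> m) \<otimes>\<^bsub>?G\<^esub> (\<lambda>i. ?\<delta> y i \<odot>\<^bsub>N\<^esub> m')"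
      by (auto simp: fun_eq_iff)
  next
    fix s y m assume s: "s \<in> carrier R" and y: "y \<in> carrier L" and m: "m \<in> carrier N"
    let ?Y = "{y, s \<odot>\<^bsub>L\<^esub> y}" and ?k' = "\<lambda>i. s \<otimes>\<^bsub>R\<^esub> ?\<delta> y i"
    have Y: "finite ?Y" "?Y \<subseteq> carrier L" using y s by auto
    \<comment> \<open>The basis function at \<open>s y\<close> and \<open>s\<close> times the basis
      function at \<open>y\<close> both have the sum \<open>s y\<close>.\<close>
    have "(\<Oplus>\<^bsub>L\<^esub>i\<in>?Y. ?k' i \<odot>\<^bsub>L\<^esub> i) = (\<Oplus>\<^bsub>L\<^esub>i\<in>?Y. s \<odot>\<^bsub>L\<^esub> (?\<delta> y i \<odot>\<^bsub>L\<^esub> i))"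
      using Y(2) s by (intro L.M.finsum_cong refl) (auto simp: simp_implies_def)
    also have "\<dots> = s \<odot>\<^bsub>L\<^esub> (\<Oplus>\<^bsub>L\<^esub>i\<in>?Y. ?\<delta> y i \<odot>\<^bsub>L\<^esub> i)"
      using Y s by (intro L.finsum_smult_ldistr[symmetric]) auto
    also have "\<dots> = (\<Oplus>\<^bsub>L\<^esub>i\<in>?Y. ?\<delta> (s \<odot>\<^bsub>L\<^esub> y) i \<odot>\<^bsub>L\<^esub> i)"
      by (simp only: finsum_indicator_smult[OF assms(1) Y] insert_iff simp_thms)
    finally have "(\<lambda>i. (?\<delta> (s \<odot>\<^bsub>L\<^esub> y) i \<ominus>\<^bsub>R\<^esub> ?k' i) \<odot>\<^bsub>N\<^esub> m) \<in> H"
      using m s Y by (intro d[of ?Y]) auto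
    moreover have "?\<delta> (s \<odot>\<^bsub>L\<^esub> y) i \<odot>\<^bsub>N\<^esub> m =
      (?\<delta> (s \<odot>\<^bsub>L\<^esub> y) i \<ominus>\<^bsub>R\<^esub> ?k' i) \<odot>\<^bsub>N\<^esub> m \<oplus>\<^bsub>N\<^esub> ?\<delta> y i \<odot>\<^bsub>N\<^esub> (s \<odot>\<^bsub>N\<^esub> m)" for i
    proof -
      have "?\<delta> y i \<odot>\<^bsub>N\<^esub> (s \<odot>\<^bsub>N\<^esub> m) = ?k' i \<odot>\<^bsub>N\<^esub> m" using s m by simp
      then show ?thesis
        using N.smult_diff_add[of "?\<delta> (s \<odot>\<^bsub>L\<^esub> y) i" "?k' i" m] m s by (simp only: split: if_splits) auto
    qed
    ultimately show "\<exists>d\<in>H. (\<lambda>i. ?\<delta> (s \<odot>\<^bsub>L\<^esub> y) i \<odot>\<^bsub>N\<^esub> m) =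
        d \<otimes>\<^bsub>?G\<^esub> (\<lambda>i. ?\<delta> y i \<odot>\<^bsub>N\<^esub> (s \<odot>\<^bsub>N\<^esub> m))"
      unfolding pointwise_group_simps fun_eq_iff by (intro bexI allI)
  qed
  then obtain h where h: "h \<in> hom (free_Abelian_group (carrier L \<times> carrier N)) ?G"
    "\<And>y m. y \<in> carrier L \<Longrightarrow> m \<in> carrier N \<Longrightarrow> h (frag_of (y, m)) = (\<lambda>i. ?\<delta> y i \<odot>\<^bsub>N\<^esub> m)"
    "h ` tensor_null R L N \<subseteq> H"
    by blast
  let ?w = "\<lambda>i. ?\<delta> l i \<odot>\<^bsub>N\<^esub> x"
  have "h (frag_of (l, x)) \<in> H" using h(3) assms(5) by blast
  then have "?w \<in> H" by (simp only: h(2)[OF assms(3,4)])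
  then obtain Y where Y: "?fin Y" "?w \<in> pointwise_span (syzygies R L Y) N" unfolding H_def by blast
  \<comment> \<open>Including \<open>l\<close> allows each relation to be split into its term at
    \<open>l\<close> and the rest.\<close>
  let ?Y = "insert l Y"
  have Y': "?fin ?Y" using Y(1) assms(3) by blast
  \<comment> \<open>Since \<open>?w\<close> is zero at every \<open>z\<close> other than
    \<open>l\<close>, flatness lets it be spanned by relations that are zero there too, one
    \<open>z\<close> at a time. The submodule property is carried along as a hypothesis of the next
    step.\<close>
  have "fun_submodule R {k \<in> syzygies R L ?Y. \<forall>z\<in>Z. k z = \<zero>\<^bsub>R\<^esub>} \<and>
    ?w \<in> pointwise_span {k \<in> syzygies R L ?Y. \<forall>z\<in>Z. k z = \<zero>\<^bsub>R\<^esub>} N"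
    if "finite Z" "l \<notin> Z" for Z
    using that
  proof (induction Z rule: finite_induct)
    case empty
    then show ?case using sub[OF Y'] mono[OF Y', of Y] Y(2) by auto
  next
    case (insert z Z)
    have eq: "{k \<in> syzygies R L ?Y. \<forall>z\<in>insert z Z. k z = \<zero>\<^bsub>R\<^esub>} =
      {k \<in> {k \<in> syzygies R L ?Y. \<forall>z\<in>Z. k z = \<zero>\<^bsub>R\<^esub>}. k z = \<zero>\<^bsub>R\<^esub>}" by blast
    have IH: "fun_submodule R {k \<in> syzygies R L ?Y. \<forall>z\<in>Z. k z = \<zero>\<^bsub>R\<^esub>}"
      "?w \<in> pointwise_span {k \<in> syzygies R L ?Y. \<forall>z\<in>Z. k z = \<zero>\<^bsub>R\<^esub>} N" using insert by auto
    have wz: "?w z = \<zero>\<^bsub>N\<^esub>" using insert.prems assms(4) by auto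
    show ?case
      unfolding eq
      using fun_submodule_kernel[OF L.R.cring_axioms IH(1)]
        flat_pointwise_span_kernel[where w = ?w, OF L.R.cring_axioms assms(2) IH wz] by blast
  qed
  from this[of "Y - {l}"] Y(1)
  have w: "?w \<in> pointwise_span {k \<in> syzygies R L ?Y. \<forall>z\<in>Y - {l}. k z = \<zero>\<^bsub>R\<^esub>} N" by simp
  \<comment> \<open>Of such a relation only the term \<open>k l\<close> times \<open>l\<close>
    remains.\<close>
  have ann: "k l \<in> annihilator R L l" if "k \<in> syzygies R L ?Y" "\<forall>z\<in>Y - {l}. k z = \<zero>\<^bsub>R\<^esub>" for k
  proof -
    have k: "\<And>i. k i \<in> carrier R" "(\<Oplus>\<^bsub>L\<^esub>i\<in>?Y. k i \<odot>\<^bsub>L\<^esub> i) = \<zero>\<^bsub>L\<^esub>" using that(1) by (auto simp: syzygies_def)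
    have "(\<Oplus>\<^bsub>L\<^esub>i\<in>insert l (Y - {l}). k i \<odot>\<^bsub>L\<^esub> i) = k l \<odot>\<^bsub>L\<^esub> l \<oplus>\<^bsub>L\<^esub> (\<Oplus>\<^bsub>L\<^esub>i\<in>Y - {l}. k i \<odot>\<^bsub>L\<^esub> i)"
      using Y(1) assms(3) k(1) by (intro L.M.finsum_insert) auto
    also have "(\<Oplus>\<^bsub>L\<^esub>i\<in>Y - {l}. k i \<odot>\<^bsub>L\<^esub> i) = \<zero>\<^bsub>L\<^esub>"
      using that(2) Y(1) by (intro L.M.add.finprod_one_eqI) auto
    finally show ?thesis using k assms(3) by (simp add: annihilator_def)
  qed
  \<comment> \<open>Evaluation at \<open>l\<close> is a homomorphism that returns \<open>x\<close>
    from \<open>?w\<close> and sends each spanning function to \<open>k l\<close> times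
    \<open>m\<close>.\<close>
  have "?w l \<in> ideal_smult (annihilator R L l) N"
  proof (rule generate_hom_subset[OF G.is_group N.M.a_group _ ideal_smult_subgroup[OF mN annihilator_carrier]
        _ _ w[unfolded pointwise_span_def], where h = "\<lambda>w. w l"])
    show "(\<lambda>w. w l) \<in> hom ?G (add_monoid N)" by (auto simp: hom_def)
    show "{\<lambda>i. k i \<odot>\<^bsub>N\<^esub> m | k m. k \<in> {k \<in> syzygies R L ?Y. \<forall>z\<in>Y - {l}. k z = \<zero>\<^bsub>R\<^esub>} \<and> m \<in> carrier N} \<subseteq> carrier ?G"
      by (auto simp: syzygies_def)
  next
    fix v assume "v \<in> {\<lambda>i. k i \<odot>\<^bsub>N\<^esub> m | k m. k \<in> {k \<in> syzygies R L ?Y. \<forall>z\<in>Y - {l}. k z = \<zero>\<^bsub>R\<^esub>} \<and> m \<in> carrier N}"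
    then obtain k m where "k \<in> syzygies R L ?Y" "\<forall>z\<in>Y - {l}. k z = \<zero>\<^bsub>R\<^esub>" "m \<in> carrier N" "v = (\<lambda>i. k i \<odot>\<^bsub>N\<^esub> m)"
      by blast
    then show "v l \<in> ideal_smult (annihilator R L l) N"
      unfolding ideal_smult_def using ann by (intro generate.incl) blast
  qed
  then show ?thesis using assms(4) by simp
qed

section \<open>Annihilators\<close>

lemma restrict_scalars_simps [simp]:
  "carrier (restrict_scalars \<phi> M) = carrier M"
  "x \<oplus>\<^bsub>restrict_scalars \<phi> M\<^esub> y = x \<oplus>\<^bsub>M\<^esub> y"
  "\<zero>\<^bsub>restrict_scalars \<phi> M\<^esub> = \<zero>\<^bsub>M\<^esub>"
  "r \<odot>\<^bsub>restrict_scalars \<phi> M\<^esub> x = \<phi> r \<odot>\<^bsub>M\<^esub> x"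
  by (simp_all add: restrict_scalars_def)

text \<open>\<open>S\<close> is commutative, so the action of \<open>s\<close> commutes with that of
  \<open>R\<close> through \<open>\<phi>\<close>; this makes \<open>id \<otimes> s\<close> well
  defined.\<close>

lemma smult_mod_hom:
  assumes "\<phi> \<in> ring_hom R S" "module S M" "s \<in> carrier S"
  shows "(\<lambda>y. s \<odot>\<^bsub>M\<^esub> y) \<in> mod_hom R (restrict_scalars \<phi> M) (restrict_scalars \<phi> M)"
proof -
  interpret M: module S M by fact
  have "s \<odot>\<^bsub>M\<^esub> (\<phi> r \<odot>\<^bsub>M\<^esub> x) = \<phi> r \<odot>\<^bsub>M\<^esub> (s \<odot>\<^bsub>M\<^esub> x)" if "r \<in> carrier R" "x \<in> carrier M" for r x
    using that assms(3) ring_hom_closed[OF assms(1) that(1)]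
    by (simp add: M.smult_assoc1[symmetric] M.R.m_comm)
  then show ?thesis
    using assms(3) by (simp add: mod_hom_def M.smult_r_distr)
qed

text \<open>The scalars in \<open>A\<close> come from \<open>R\<close>, but the generated subgroup
  is stable under \<open>S\<close>, since \<open>s (a x) = a (s x)\<close> on generators.\<close>

lemma ideal_smult_submodule:
  fixes M :: "('s, 'm, 'w) module_scheme"
  assumes "\<phi> \<in> ring_hom R S" "module S M" "module R (restrict_scalars \<phi> M)" "A \<subseteq> carrier R"
  shows "submodule (ideal_smult A (restrict_scalars \<phi> M)) S M"
proof -
  let ?N = "restrict_scalars \<phi> M"
  let ?P = "ideal_smult A ?N"
  interpret M: module S M by fact
  interpret N: module R ?N by fact
  interpret P: subgroup ?P "add_monoid ?N" by (rule ideal_smult_subgroup[OF assms(3,4)])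
  show ?thesis
  proof (rule M.submoduleI)
    show "?P \<subseteq> carrier M" using P.subset by simp
    show "\<zero>\<^bsub>M\<^esub> \<in> ?P" using P.one_closed by simp
    show "\<ominus>\<^bsub>M\<^esub> a \<in> ?P" if "a \<in> ?P" for a
      using P.m_inv_closed[OF that] by (simp add: a_inv_def m_inv_def)
    show "a \<oplus>\<^bsub>M\<^esub> b \<in> ?P" if "a \<in> ?P" "b \<in> ?P" for a b
      using P.m_closed[OF that] by simp
  next
    fix s x assume s: "s \<in> carrier S" and x: "x \<in> ?P"
    note hom = smult_mod_hom[OF assms(1,2) s]
    show "s \<odot>\<^bsub>M\<^esub> x \<in> ?P"
    proof (rule generate_hom_subset[OF N.M.a_group N.M.a_group _ P.subgroup_axioms _ _ x[unfolded ideal_smult_def]])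
      show "(\<lambda>y. s \<odot>\<^bsub>M\<^esub> y) \<in> hom (add_monoid ?N) (add_monoid ?N)"
        using hom by (auto simp: mod_hom_def hom_def)
      show "{a \<odot>\<^bsub>?N\<^esub> x | a x. a \<in> A \<and> x \<in> carrier ?N} \<subseteq> carrier (add_monoid ?N)"
        using assms(4) N.smult_closed by auto
    next
      fix y assume "y \<in> {a \<odot>\<^bsub>?N\<^esub> x | a x. a \<in> A \<and> x \<in> carrier ?N}"
      then obtain a x where a: "a \<in> A" "x \<in> carrier ?N" "y = a \<odot>\<^bsub>?N\<^esub> x" by blast
      then have "s \<odot>\<^bsub>M\<^esub> y = a \<odot>\<^bsub>?N\<^esub> (s \<odot>\<^bsub>M\<^esub> x)" "s \<odot>\<^bsub>M\<^esub> x \<in> carrier ?N"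
        using hom assms(4) s by (auto simp: mod_hom_def)
      with a(1) show "s \<odot>\<^bsub>M\<^esub> y \<in> ?P" unfolding ideal_smult_def by (intro generate.incl) blast
    qed
  qed
qed

text \<open>Lets the containment of an ideal in the colon set be tested on generators.\<close>

lemma colon_ideal:
  assumes "module S M" "submodule P S M" "x \<in> carrier M"
  shows "ideal {s \<in> carrier S. s \<odot>\<^bsub>M\<^esub> x \<in> P} S"
proof -
  interpret M: module S M by fact
  note P = M.submoduleE[OF assms(2)]
  have zero: "\<zero>\<^bsub>M\<^esub> \<in> P" using subgroup.one_closed[OF submodule.axioms(1)[OF assms(2)]] by simp
  show ?thesis
  proof (rule idealI[OF M.R.ring_axioms])
    show "subgroup {s \<in> carrier S. s \<odot>\<^bsub>M\<^esub> x \<in> P} (add_monoid S)"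
    proof (rule group.subgroupI[OF M.R.a_group])
      show "{s \<in> carrier S. s \<odot>\<^bsub>M\<^esub> x \<in> P} \<noteq> {}"
        using zero M.smult_l_null[OF assms(3)] by (metis (mono_tags, lifting) M.R.zero_closed empty_iff mem_Collect_eq)
    qed (use assms(3) P(3,5) in \<open>auto simp: a_inv_def[symmetric] M.smult_l_minus M.smult_l_distr\<close>)
  next
    fix a s assume "a \<in> {s \<in> carrier S. s \<odot>\<^bsub>M\<^esub> x \<in> P}" "s \<in> carrier S"
    then show "s \<otimes>\<^bsub>S\<^esub> a \<in> {s \<in> carrier S. s \<odot>\<^bsub>M\<^esub> x \<in> P}" "a \<otimes>\<^bsub>S\<^esub> s \<in> {s \<in> carrier S. s \<odot>\<^bsub>M\<^esub> x \<in> P}"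
      using assms(3) P(4) M.R.m_comm[of a s] by (auto simp: M.smult_assoc1)
  qed
qed

lemma annihilator_quotient_module:
  assumes "module S M" "submodule P S M" "x \<in> carrier M"
  shows "annihilator S (quotient_module M P) (P +>\<^bsub>M\<^esub> x) = {s \<in> carrier S. s \<odot>\<^bsub>M\<^esub> x \<in> P}"
proof -
  interpret M: module S M by fact
  note P = M.submoduleE[OF assms(2)]
  have sub: "subgroup P (add_monoid M)" by (rule submodule.axioms(1)[OF assms(2)])
  have join: "P +>\<^bsub>M\<^esub> y = P \<longleftrightarrow> y \<in> P" if "y \<in> carrier M" for y
    using M.M.add.coset_join1[of P y] M.M.add.coset_join2[of y P] that sub by (auto simp: a_r_coset_def)
  \<comment> \<open>All representatives \<open>q + x\<close> give the same coset, because
    \<open>s q\<close> stays in the submodule \<open>P\<close>.\<close>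
  have "(\<Union>x'\<in>P +>\<^bsub>M\<^esub> x. P +>\<^bsub>M\<^esub> (s \<odot>\<^bsub>M\<^esub> x')) = P +>\<^bsub>M\<^esub> (s \<odot>\<^bsub>M\<^esub> x)" if s: "s \<in> carrier S" for s
  proof -
    have "P +>\<^bsub>M\<^esub> (s \<odot>\<^bsub>M\<^esub> x') = P +>\<^bsub>M\<^esub> (s \<odot>\<^bsub>M\<^esub> x)" if x': "x' \<in> P +>\<^bsub>M\<^esub> x" for x'
    proof -
      obtain q where q: "q \<in> P" "x' = q \<oplus>\<^bsub>M\<^esub> x" using x' by (auto simp: a_r_coset_def r_coset_def)
      then have "s \<odot>\<^bsub>M\<^esub> x' = s \<odot>\<^bsub>M\<^esub> q \<oplus>\<^bsub>M\<^esub> s \<odot>\<^bsub>M\<^esub> x"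
        using s assms(3) P(1) by (auto simp: M.smult_r_distr)
      moreover have "s \<odot>\<^bsub>M\<^esub> q \<in> P" by (rule P(4)[OF s q(1)])
      ultimately have "s \<odot>\<^bsub>M\<^esub> x' \<in> P +>\<^bsub>M\<^esub> (s \<odot>\<^bsub>M\<^esub> x)" by (auto simp: a_r_coset_def r_coset_def)
      then show ?thesis
        using M.M.add.repr_independence[of "s \<odot>\<^bsub>M\<^esub> x'" P "s \<odot>\<^bsub>M\<^esub> x"] sub s assms(3)
        by (simp add: a_r_coset_def)
    qed
    moreover have "x \<in> P +>\<^bsub>M\<^esub> x"
      using M.M.add.rcos_self[of x P] sub assms(3) by (simp add: a_r_coset_def)
    ultimately show ?thesis by blast
  qed
  then show ?thesis
    using join assms(3) unfolding annihilator_def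
    by (intro Collect_cong conj_cong refl) (simp add: quotient_module_def)
qed

text \<open>Since \<open>s (l \<otimes> x) = l \<otimes> s x\<close>, the claim is a criterion for a
  vanishing pure tensor: balancing gives one direction, flatness the other.\<close>

lemma annihilator_tensor_module:
  assumes "\<phi> \<in> ring_hom R S" "module R L" "module S M" "flat_module R (restrict_scalars \<phi> M)"
    and "l \<in> carrier L" "x \<in> carrier M"
  shows "annihilator S (tensor_module R \<phi> L M)
      (tensor_null R L (restrict_scalars \<phi> M) #>\<^bsub>free_Abelian_group (carrier L \<times> carrier M)\<^esub> frag_of (l, x)) =
    {s \<in> carrier S. s \<odot>\<^bsub>M\<^esub> x \<in> ideal_smult (annihilator R L l) (restrict_scalars \<phi> M)}"
proof -
  let ?N = "restrict_scalars \<phi> M"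
  interpret M: module S M by fact
  have mN: "module R ?N" using assms(4) by (simp add: flat_module_def)
  have id: "(\<lambda>x. x) \<in> mod_hom R L L" by (simp add: mod_hom_def)
  let ?T = "\<lambda>y. tensor_null R L ?N #>\<^bsub>free_Abelian_group (carrier L \<times> carrier M)\<^esub> frag_of (l, y)"
  have "s \<odot>\<^bsub>tensor_module R \<phi> L M\<^esub> ?T x = ?T (s \<odot>\<^bsub>M\<^esub> x)" if "s \<in> carrier S" for s
    using tensor_map_coset[OF assms(2) mN assms(2) mN id smult_mod_hom[OF assms(1,3) that], of "frag_of (l, x)"]
      assms(5,6) by (simp add: tensor_module_def Let_def)
  moreover have "\<zero>\<^bsub>tensor_module R \<phi> L M\<^esub> = tensor_null R L ?N"
    by (simp add: tensor_module_def Let_def tensor_group_def FactGroup_def)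
  moreover have "?T y = tensor_null R L ?N \<longleftrightarrow> y \<in> ideal_smult (annihilator R L l) ?N" if "y \<in> carrier M" for y
  proof -
    have "?T y = tensor_null R L ?N \<longleftrightarrow> frag_of (l, y) \<in> tensor_null R L ?N"
      using tensor_null_coset_eq[OF assms(2) mN, of "frag_of (l, y)"] that assms(5) by simp
    also have "\<dots> \<longleftrightarrow> y \<in> ideal_smult (annihilator R L l) ?N"
      using tensor_null_if_annihilated[OF assms(2) mN assms(5)]
        flat_annihilated_if_tensor_null[OF assms(2,4,5)] that by (intro iffI) simp_all
    finally show ?thesis .
  qed
  ultimately show ?thesis
    using assms(6) unfolding annihilator_def[of S] by (intro Collect_cong conj_cong refl) simp
qed

section \<open>Strong Krull primes of the tensor product\<close>

theorem theorem4p1: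
  fixes R :: "('r, 'x) ring_scheme" and S :: "('s, 'y) ring_scheme"
    and \<phi> :: "'r \<Rightarrow> 's"
    and L :: "('r, 'l, 'z) module_scheme" and M :: "('s, 'm, 'w) module_scheme"
  assumes "cring R" and "cring S" and "\<phi> \<in> ring_hom R S"
    and "module R L" and "module S M"
    and "flat_module R (restrict_scalars \<phi> M)"
  shows "strong_Krull S (tensor_module R \<phi> L M) \<supseteq>
    (\<Union>p\<in>strong_Krull R L.
       strong_Krull S (quotient_module M (ideal_smult p (restrict_scalars \<phi> M))))"
proof (intro UN_least subsetI)
  let ?N = "restrict_scalars \<phi> M"
  let ?T = "tensor_module R \<phi> L M"
  fix p q
  assume p: "p \<in> strong_Krull R L" and q: "q \<in> strong_Krull S (quotient_module M (ideal_smult p ?N))"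
  interpret R: cring R by fact
  interpret S: cring S by fact
  interpret L: module R L by fact
  interpret M: module S M by fact
  have mN: "module R ?N" using assms(6) by (simp add: flat_module_def)
  have prime: "primeideal p R" "primeideal q S" using p q by (auto simp: strong_Krull_def)
  have idp: "ideal p R" by (rule primeideal.axioms(1)[OF prime(1)])
  have pR: "p \<subseteq> carrier R" using ideal.Icarr[OF idp] by blast
  note sub = ideal_smult_submodule[OF assms(3,5) mN]
  have "\<exists>z\<in>carrier ?T. J \<subseteq> annihilator S ?T z \<and> annihilator S ?T z \<subseteq> q"
    if J: "fin_gen_ideal J S" "J \<subseteq> q" for J
  proof -
    obtain F where F: "finite F" "F \<subseteq> carrier S" "J = genideal S F"
      using J(1) by (auto simp: fin_gen_ideal_def)
    obtain z where z: "z \<in> carrier (quotient_module M (ideal_smult p ?N))"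
      "J \<subseteq> annihilator S (quotient_module M (ideal_smult p ?N)) z"
      "annihilator S (quotient_module M (ideal_smult p ?N)) z \<subseteq> q"
      using q J by (auto simp: strong_Krull_def)
    from z(1) obtain x where x: "x \<in> carrier M" "z = ideal_smult p ?N +>\<^bsub>M\<^esub> x"
      by (auto simp: quotient_module_def A_RCOSETS_def RCOSETS_def a_r_coset_def)
    note ann_z = annihilator_quotient_module[OF assms(5) sub[OF pR] x(1), folded x(2)]
    \<comment> \<open>Each generator of \<open>J\<close> sends \<open>x\<close> into
      \<open>p M\<close>, and only finitely many elements of \<open>p\<close> are involved.\<close>
    have "\<exists>B. finite B \<and> B \<subseteq> p \<and> s \<odot>\<^bsub>M\<^esub> x \<in> ideal_smult B ?N" if "s \<in> F" for s
    proof -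
      have "s \<in> J" using that S.genideal_self[OF F(2)] F(3) by blast
      then have "s \<odot>\<^bsub>M\<^esub> x \<in> ideal_smult p ?N" using z(2) ann_z by blast
      then show ?thesis by (rule ideal_smult_finite[OF mN pR])
    qed
    then obtain B where B: "\<And>s. s \<in> F \<Longrightarrow> finite (B s) \<and> B s \<subseteq> p \<and> s \<odot>\<^bsub>M\<^esub> x \<in> ideal_smult (B s) ?N"
      by metis
    \<comment> \<open>Finiteness of \<open>F\<close> keeps \<open>A\<close> finite, so the strong
      Krull property of \<open>p\<close> applies to the ideal generated by \<open>A\<close> and
      supplies \<open>l\<close>.\<close>
    define A where "A = (\<Union>s\<in>F. B s)"
    have A: "finite A" "A \<subseteq> p" using B F(1) by (auto simp: A_def)
    then have "fin_gen_ideal (genideal R A) R" "genideal R A \<subseteq> p"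
      using pR R.genideal_minimal[OF idp A(2)] by (auto simp: fin_gen_ideal_def)
    then obtain l where l: "l \<in> carrier L" "genideal R A \<subseteq> annihilator R L l" "annihilator R L l \<subseteq> p"
      using p unfolding strong_Krull_def by blast
    \<comment> \<open>The witness is the pure tensor \<open>l \<otimes> x\<close>.\<close>
    let ?z = "tensor_null R L ?N #>\<^bsub>free_Abelian_group (carrier L \<times> carrier M)\<^esub> frag_of (l, x)"
    note ann = annihilator_tensor_module[OF assms(3-6) l(1) x(1)]
    have "?z \<in> carrier ?T"
      using l(1) x(1) by (auto simp: tensor_module_def Let_def tensor_group_def FactGroup_def RCOSETS_def)
    \<comment> \<open>The annihilator of \<open>?z\<close> is a colon ideal, so the generators in
      \<open>F\<close> suffice.\<close>
    moreover have "J \<subseteq> annihilator S ?T ?z"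
      unfolding F(3) ann
    proof (rule S.genideal_minimal[OF colon_ideal[OF assms(5) sub[OF annihilator_carrier] x(1)]], rule subsetI)
      fix s assume s: "s \<in> F"
      have "B s \<subseteq> annihilator R L l"
        using s l(2) R.genideal_self[of A] A(2) pR by (auto simp: A_def)
      from subsetD[OF ideal_smult_mono[OF mN this annihilator_carrier]]
      have "s \<odot>\<^bsub>M\<^esub> x \<in> ideal_smult (annihilator R L l) ?N"
        using B[OF s] by simp
      then show "s \<in> {s \<in> carrier S. s \<odot>\<^bsub>M\<^esub> x \<in> ideal_smult (annihilator R L l) ?N}"
        using s F(2) by blast
    qed
    \<comment> \<open>From \<open>ann(l) \<subseteq> p\<close> follows
      \<open>ann(l) M \<subseteq> p M\<close>, which compares the two colon ideals.\<close>
    moreover have "annihilator S ?T ?z \<subseteq> q"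
    proof -
      have "annihilator S ?T ?z \<subseteq> annihilator S (quotient_module M (ideal_smult p ?N)) z"
        unfolding ann ann_z by (intro Collect_mono impI conj_mono) (use ideal_smult_mono[OF mN l(3) pR] in \<open>simp_all add: subsetD\<close>)
      then show ?thesis using z(3) by (rule subset_trans)
    qed
    ultimately show ?thesis by blast
  qed
  with prime(2) show "q \<in> strong_Krull S ?T" by (auto simp: strong_Krull_def)
qed

end
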